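(* Let $G$ be a groupoid over $M$ in a tangent category, let $\pi:A\to M$ with zero section $\xi$, lift $\lambda$ and anchor $\varrho$ be its associated anchored bundle, and define $\alpha:A\times_{\varrho,T(\pi)}T(A)\to T(A)$ by $$\alpha(v,w)=cw\circ 0v\circ(c0pw)^{-1}.$$ Then $$\alpha(\xi\pi,\lambda)=\lambda,\qquad T(\varrho)\alpha=cT(\varrho)\pi_1,\qquad \alpha(p\pi_1,\alpha)=\pi_1,$$ where $\pi_1:A\times_{\varrho,T(\pi)}T(A)\to T(A)$ is the projection.
   Context: Conventions: composition of arrows is juxtaposition in applicative order ($gf$: first $f$, then $g$); subscripts of natural transformations are omitted; equations may be read on generalised elements. An additive bundle over $M$ is a commutative monoid in the slice category over $M$: an arrow $q:E\to M$, zero $\xi:M\to E$, addition $+_q$. A morphism is a commuting square preserving zero and addition. A tangent category is a category with an endofunctor $T$ and natural transformations $p:T\Rightarrow\mathrm{id}$, $0:\mathrm{id}\Rightarrow T$, $+:T\times_{p,p}T\Rightarrow T$, $l:T\Rightarrow T^2$, $c:T^2\Rightarrow T^2$ such that: pullback powers of $p$ exist and are preserved by $T$; each $(p_M,0_M,+_M)$ is an additive bundle; $(l,0):p\Rightarrow T(p)$ and $(c,\mathrm{id}):T(p)\Rightarrow p$ are additive bundle morphisms; $cc=\mathrm{id}$, $T(c)cT(c)=cT(c)c$, $cl=l$, $T(l)l=ll$, $cT(c)l=T(l)c$; and $\mu(a,b)=T(+)(0b,la)$, $T(M)\times_MT(M)\to T^2(M)$, is an equaliser of $T(p)$ and $0pp$.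 Standing assumptions: negatives (additive bundles are commutative groups in the slice) and all limits used exist and are preserved by $T$. The groupoid $G$ has identity $e:M\to G$, source and target $s,t:G\to M$, inverse $(-)^{-1}$; $g\circ h$ is defined when $s(g)=t(h)$. In $T^2(G)$, $\circ$ and $(-)^{-1}$ denote the operations obtained by applying $T^2$, so $g\circ h$ is defined when $T^2(s)g=T^2(t)h$. Associated anchored bundle: $A$ is the pullback of $(p,T(s)):T(G)\to G\times T(M)$ along $(e,0):M\to G\times T(M)$, with projection $\pi:A\to M$ and monomorphism $\iota:A\rightarrowtail T(G)$. Thus elements of $A$ are $v\in T(G)$ with $pv=em$, $T(s)v=0m$, $m=\pi v$; elements of $T(A)$ are regarded as elements $w\in T^2(G)$ with $T(p)w=T(e)T(\pi)w$ and $T^2(s)w=T(0)T(\pi)w$. Zero section, addition and lift are inherited from $(T(G),p)$: $\xi=0e$, $\lambda v=lv$. The anchor is $\varrho=T(t)\iota:A\to T(M)$. The prolongation $A\times_{\varrho,T(\pi)}T(A)$ is the pullback of $\varrho$ and $T(\pi):T(A)\to T(M)$, projections $\pi_0,\pi_1$. The composite defining $\alpha(v,w)$ is defined in $T^2(G)$ and lies in $T(A)$. *)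

theory Defs
  imports Main
begin

section \<open>Categories and limits\<close>

record ('o, 'a) cat =
  Obj :: "'o set"
  Arr :: "'a set"
  Dom :: "'a \<Rightarrow> 'o"
  Cod :: "'a \<Rightarrow> 'o"
  Id :: "'o \<Rightarrow> 'a"
  Comp :: "'a \<Rightarrow> 'a \<Rightarrow> 'a" (infixr "\<cdot>\<index>" 70)

definition Hom :: "('o, 'a, 'z) cat_scheme \<Rightarrow> 'o \<Rightarrow> 'o \<Rightarrow> 'a set" where
  "Hom C X Y = {f \<in> Arr C. Dom C f = X \<and> Cod C f = Y}"

text \<open>Composition is written in applicative order and is meaningful only when
  \<open>Dom C g = Cod C f\<close>; nothing is assumed outside this domain.\<close>

locale cat =
  fixes C :: "('o, 'a, 'z) cat_scheme" (structure)
  assumes Dom_Obj: "f \<in> Arr C \<Longrightarrow> Dom C f \<in> Obj C"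
    and Cod_Obj: "f \<in> Arr C \<Longrightarrow> Cod C f \<in> Obj C"
    and Id_Hom: "X \<in> Obj C \<Longrightarrow> Id C X \<in> Hom C X X"
    and Comp_Hom: "f \<in> Hom C X Y \<Longrightarrow> g \<in> Hom C Y Z \<Longrightarrow> g \<cdot> f \<in> Hom C X Z"
    and Comp_Id: "f \<in> Hom C X Y \<Longrightarrow> f \<cdot> Id C X = f"
    and Id_Comp: "f \<in> Hom C X Y \<Longrightarrow> Id C Y \<cdot> f = f"
    and Comp_assoc:
      "f \<in> Hom C W X \<Longrightarrow> g \<in> Hom C X Y \<Longrightarrow> h \<in> Hom C Y Z \<Longrightarrow> (h \<cdot> g) \<cdot> f = h \<cdot> (g \<cdot> f)"

definition is_pullback ::
  "('o, 'a, 'z) cat_scheme \<Rightarrow> 'a \<Rightarrow> 'a \<Rightarrow> 'a \<Rightarrow> 'a \<Rightarrow> bool" where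
  "is_pullback C f g r0 r1 \<longleftrightarrow>
     f \<in> Arr C \<and> g \<in> Arr C \<and> Cod C f = Cod C g \<and>
     r0 \<in> Hom C (Dom C r0) (Dom C f) \<and> r1 \<in> Hom C (Dom C r0) (Dom C g) \<and>
     Comp C f r0 = Comp C g r1 \<and>
     (\<forall>X. \<forall>u \<in> Hom C X (Dom C f). \<forall>v \<in> Hom C X (Dom C g).
        Comp C f u = Comp C g v \<longrightarrow>
        (\<exists>!h. h \<in> Hom C X (Dom C r0) \<and> Comp C r0 h = u \<and> Comp C r1 h = v))"

definition is_product ::
  "('o, 'a, 'z) cat_scheme \<Rightarrow> 'o \<Rightarrow> 'o \<Rightarrow> 'a \<Rightarrow> 'a \<Rightarrow> bool" where
  "is_product C A B r0 r1 \<longleftrightarrow>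
     A \<in> Obj C \<and> B \<in> Obj C \<and>
     r0 \<in> Hom C (Dom C r0) A \<and> r1 \<in> Hom C (Dom C r0) B \<and>
     (\<forall>X. \<forall>u \<in> Hom C X A. \<forall>v \<in> Hom C X B.
        \<exists>!h. h \<in> Hom C X (Dom C r0) \<and> Comp C r0 h = u \<and> Comp C r1 h = v)"

text \<open>The \<open>n\<close>-th pullback power of \<open>q : E \<rightarrow> M\<close>, with projections \<open>rs i : L \<rightarrow> E\<close>
  for \<open>i < n\<close>. The leg \<open>r : L \<rightarrow> M\<close> is the common composite \<open>q \<cdot> rs i\<close>; it is
  recorded separately so that \<open>n = 0\<close> needs no special treatment.\<close>

definition is_pullback_power ::
  "('o, 'a, 'z) cat_scheme \<Rightarrow> nat \<Rightarrow> 'a \<Rightarrow> 'a \<Rightarrow> (nat \<Rightarrow> 'a) \<Rightarrow> bool" where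
  "is_pullback_power C n q r rs \<longleftrightarrow>
     q \<in> Arr C \<and> r \<in> Hom C (Dom C r) (Cod C q) \<and>
     (\<forall>i<n. rs i \<in> Hom C (Dom C r) (Dom C q) \<and> Comp C q (rs i) = r) \<and>
     (\<forall>X us. \<forall>x \<in> Hom C X (Cod C q).
        (\<forall>i<n. us i \<in> Hom C X (Dom C q) \<and> Comp C q (us i) = x) \<longrightarrow>
        (\<exists>!h. h \<in> Hom C X (Dom C r) \<and> Comp C r h = x \<and> (\<forall>i<n. Comp C (rs i) h = us i)))"

definition is_equaliser ::
  "('o, 'a, 'z) cat_scheme \<Rightarrow> 'a \<Rightarrow> 'a \<Rightarrow> 'a \<Rightarrow> bool" where
  "is_equaliser C f g m \<longleftrightarrow>
     f \<in> Arr C \<and> g \<in> Hom C (Dom C f) (Cod C f) \<and> m \<in> Hom C (Dom C m) (Dom C f) \<and>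
     Comp C f m = Comp C g m \<and>
     (\<forall>X. \<forall>u \<in> Hom C X (Dom C f). Comp C f u = Comp C g u \<longrightarrow>
        (\<exists>!h. h \<in> Hom C X (Dom C m) \<and> Comp C m h = u))"

text \<open>\<open>pair C r0 r1 u v\<close> is the arrow \<open>(u, v)\<close> into the pullback or product with projections
  \<open>r0\<close>, \<open>r1\<close>; \<open>lift_through C m u\<close> is the factorisation of \<open>u\<close> through a monomorphism \<open>m\<close>.
  Both are unspecified if there is no unique such arrow.\<close>

definition pair :: "('o, 'a, 'z) cat_scheme \<Rightarrow> 'a \<Rightarrow> 'a \<Rightarrow> 'a \<Rightarrow> 'a \<Rightarrow> 'a" where
  "pair C r0 r1 u v =
     (THE h. h \<in> Hom C (Dom C u) (Dom C r0) \<and> Comp C r0 h = u \<and> Comp C r1 h = v)"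

definition lift_through :: "('o, 'a, 'z) cat_scheme \<Rightarrow> 'a \<Rightarrow> 'a \<Rightarrow> 'a" where
  "lift_through C m u = (THE h. h \<in> Hom C (Dom C u) (Dom C m) \<and> Comp C m h = u)"

section \<open>Additive bundles\<close>

text \<open>The fields \<open>bfst\<close>, \<open>bsnd\<close> are the projections of the chosen pullback \<open>E \<times>\<^sub>M E\<close>, the domain
  of the addition. The monoid laws in the slice over \<open>M\<close> are stated on generalised elements.\<close>

record 'a abundle =
  bproj :: 'a
  bzero :: 'a
  badd :: 'a
  bfst :: 'a
  bsnd :: 'a

definition bplus :: "('o, 'a, 'z) cat_scheme \<Rightarrow> 'a abundle \<Rightarrow> 'a \<Rightarrow> 'a \<Rightarrow> 'a" where
  "bplus C B u v = Comp C (badd B) (pair C (bfst B) (bsnd B) u v)"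

locale additive_bundle = cat +
  fixes B :: "'a abundle"
  assumes proj: "bproj B \<in> Arr C"
    and zero: "bzero B \<in> Hom C (Cod C (bproj B)) (Dom C (bproj B))"
    and add: "badd B \<in> Hom C (Dom C (bfst B)) (Dom C (bproj B))"
    and pullback: "is_pullback C (bproj B) (bproj B) (bfst B) (bsnd B)"
    and proj_zero: "bproj B \<cdot> bzero B = Id C (Cod C (bproj B))"
    and proj_add: "bproj B \<cdot> badd B = bproj B \<cdot> bfst B"
    and zero_left: "u \<in> Hom C X (Dom C (bproj B)) \<Longrightarrow>
          bplus C B (bzero B \<cdot> bproj B \<cdot> u) u = u"
    and add_commute: "u \<in> Hom C X (Dom C (bproj B)) \<Longrightarrow> v \<in> Hom C X (Dom C (bproj B)) \<Longrightarrow>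
          bproj B \<cdot> u = bproj B \<cdot> v \<Longrightarrow> bplus C B u v = bplus C B v u"
    and add_assoc: "u \<in> Hom C X (Dom C (bproj B)) \<Longrightarrow> v \<in> Hom C X (Dom C (bproj B)) \<Longrightarrow>
          w \<in> Hom C X (Dom C (bproj B)) \<Longrightarrow>
          bproj B \<cdot> u = bproj B \<cdot> v \<Longrightarrow> bproj B \<cdot> v = bproj B \<cdot> w \<Longrightarrow>
          bplus C B (bplus C B u v) w = bplus C B u (bplus C B v w)"

text \<open>\<open>(f, g)\<close> with \<open>f\<close> between the total and \<open>g\<close> between the base objects.\<close>

definition additive_bundle_morphism ::
  "('o, 'a, 'z) cat_scheme \<Rightarrow> 'a abundle \<Rightarrow> 'a abundle \<Rightarrow> 'a \<Rightarrow> 'a \<Rightarrow> bool" where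
  "additive_bundle_morphism C B B' f g \<longleftrightarrow>
     additive_bundle C B \<and> additive_bundle C B' \<and>
     f \<in> Hom C (Dom C (bproj B)) (Dom C (bproj B')) \<and>
     g \<in> Hom C (Cod C (bproj B)) (Cod C (bproj B')) \<and>
     Comp C (bproj B') f = Comp C g (bproj B) \<and>
     Comp C f (bzero B) = Comp C (bzero B') g \<and>
     Comp C f (badd B) = bplus C B' (Comp C f (bfst B)) (Comp C f (bsnd B))"

section \<open>Tangent categories\<close>

text \<open>\<open>tfst M\<close>, \<open>tsnd M\<close> are the projections of the chosen pullback \<open>T(M) \<times>\<^sub>M T(M)\<close>.\<close>

record ('o, 'a) tancat = "('o, 'a) cat" +
  TO :: "'o \<Rightarrow> 'o"
  TA :: "'a \<Rightarrow> 'a"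
  tp :: "'o \<Rightarrow> 'a"
  tzero :: "'o \<Rightarrow> 'a"
  tadd :: "'o \<Rightarrow> 'a"
  tfst :: "'o \<Rightarrow> 'a"
  tsnd :: "'o \<Rightarrow> 'a"
  tl :: "'o \<Rightarrow> 'a"
  tc :: "'o \<Rightarrow> 'a"

definition tangent_bundle :: "('o, 'a, 'z) tancat_scheme \<Rightarrow> 'o \<Rightarrow> 'a abundle" where
  "tangent_bundle C M =
     \<lparr>bproj = tp C M, bzero = tzero C M, badd = tadd C M, bfst = tfst C M, bsnd = tsnd C M\<rparr>"

definition T_bundle :: "('o, 'a, 'z) tancat_scheme \<Rightarrow> 'a abundle \<Rightarrow> 'a abundle" where
  "T_bundle C B =
     \<lparr>bproj = TA C (bproj B), bzero = TA C (bzero B), badd = TA C (badd B),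
      bfst = TA C (bfst B), bsnd = TA C (bsnd B)\<rparr>"

text \<open>\<open>\<mu>(a, b) = T(+)(0b, la)\<close>, where \<open>a\<close>, \<open>b\<close> are the two projections.\<close>

definition tmu :: "('o, 'a, 'z) tancat_scheme \<Rightarrow> 'o \<Rightarrow> 'a" where
  "tmu C M = bplus C (T_bundle C (tangent_bundle C M))
     (Comp C (tzero C (TO C M)) (tsnd C M)) (Comp C (tl C M) (tfst C M))"

locale tangent_category = cat C
  for C :: "('o, 'a, 'z) tancat_scheme" (structure) +
  \<comment> \<open>\<open>T\<close> is an endofunctor\<close>
  assumes TO_Obj: "M \<in> Obj C \<Longrightarrow> TO C M \<in> Obj C"
    and TA_Hom: "f \<in> Hom C X Y \<Longrightarrow> TA C f \<in> Hom C (TO C X) (TO C Y)"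
    and TA_Id: "M \<in> Obj C \<Longrightarrow> TA C (Id C M) = Id C (TO C M)"
    and TA_Comp: "f \<in> Hom C X Y \<Longrightarrow> g \<in> Hom C Y Z \<Longrightarrow> TA C (g \<cdot> f) = TA C g \<cdot> TA C f"
  \<comment> \<open>natural transformations\<close>
    and tp_Hom: "M \<in> Obj C \<Longrightarrow> tp C M \<in> Hom C (TO C M) M"
    and tp_nat: "f \<in> Hom C X Y \<Longrightarrow> tp C Y \<cdot> TA C f = f \<cdot> tp C X"
    and tzero_Hom: "M \<in> Obj C \<Longrightarrow> tzero C M \<in> Hom C M (TO C M)"
    and tzero_nat: "f \<in> Hom C X Y \<Longrightarrow> tzero C Y \<cdot> f = TA C f \<cdot> tzero C X"
    and tadd_Hom: "M \<in> Obj C \<Longrightarrow> tadd C M \<in> Hom C (Dom C (tfst C M)) (TO C M)"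
    and tadd_nat: "f \<in> Hom C X Y \<Longrightarrow>
          bplus C (tangent_bundle C Y) (TA C f \<cdot> tfst C X) (TA C f \<cdot> tsnd C X) = TA C f \<cdot> tadd C X"
    and tl_Hom: "M \<in> Obj C \<Longrightarrow> tl C M \<in> Hom C (TO C M) (TO C (TO C M))"
    and tl_nat: "f \<in> Hom C X Y \<Longrightarrow> tl C Y \<cdot> TA C f = TA C (TA C f) \<cdot> tl C X"
    and tc_Hom: "M \<in> Obj C \<Longrightarrow> tc C M \<in> Hom C (TO C (TO C M)) (TO C (TO C M))"
    and tc_nat: "f \<in> Hom C X Y \<Longrightarrow> tc C Y \<cdot> TA C (TA C f) = TA C (TA C f) \<cdot> tc C X"
  \<comment> \<open>pullback powers of \<open>p\<close> exist and are preserved by \<open>T\<close>\<close>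
    and powers_exist: "M \<in> Obj C \<Longrightarrow> \<exists>r rs. is_pullback_power C n (tp C M) r rs"
    and powers_preserved: "M \<in> Obj C \<Longrightarrow> is_pullback_power C n (tp C M) r rs \<Longrightarrow>
          is_pullback_power C n (TA C (tp C M)) (TA C r) (\<lambda>i. TA C (rs i))"
  \<comment> \<open>additivity\<close>
    and tangent_additive: "M \<in> Obj C \<Longrightarrow> additive_bundle C (tangent_bundle C M)"
    and tl_additive: "M \<in> Obj C \<Longrightarrow>
          additive_bundle_morphism C (tangent_bundle C M) (T_bundle C (tangent_bundle C M))
            (tl C M) (tzero C M)"
    and tc_additive: "M \<in> Obj C \<Longrightarrow>
          additive_bundle_morphism C (T_bundle C (tangent_bundle C M)) (tangent_bundle C (TO C M))
            (tc C M) (Id C (TO C M))"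
  \<comment> \<open>coherence of \<open>l\<close> and \<open>c\<close>\<close>
    and tc_tc: "M \<in> Obj C \<Longrightarrow> tc C M \<cdot> tc C M = Id C (TO C (TO C M))"
    and tc_braid: "M \<in> Obj C \<Longrightarrow>
          TA C (tc C M) \<cdot> tc C (TO C M) \<cdot> TA C (tc C M) =
          tc C (TO C M) \<cdot> TA C (tc C M) \<cdot> tc C (TO C M)"
    and tc_tl: "M \<in> Obj C \<Longrightarrow> tc C M \<cdot> tl C M = tl C M"
    and tl_tl: "M \<in> Obj C \<Longrightarrow> TA C (tl C M) \<cdot> tl C M = tl C (TO C M) \<cdot> tl C M"
    and tc_T_tc_tl: "M \<in> Obj C \<Longrightarrow>
          tc C (TO C M) \<cdot> TA C (tc C M) \<cdot> tl C (TO C M) = TA C (tl C M) \<cdot> tc C M"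
  \<comment> \<open>universality of the lift\<close>
    and tmu_equaliser: "M \<in> Obj C \<Longrightarrow>
          is_equaliser C (TA C (tp C M)) (tzero C M \<cdot> tp C M \<cdot> tp C (TO C M)) (tmu C M)"

locale tangent_category_with_negatives = tangent_category +
  assumes negatives: "M \<in> Obj C \<Longrightarrow> \<exists>n \<in> Hom C (TO C M) (TO C M).
          tp C M \<cdot> n = tp C M \<and>
          bplus C (tangent_bundle C M) n (Id C (TO C M)) = tzero C M \<cdot> tp C M"

text \<open>Limits that are preserved by all iterates of \<open>T\<close> (including the zeroth): the image under
  \<open>T\<close> of a limit in use counts as a limit in use.\<close>

definition T_pullback ::
  "('o, 'a, 'z) tancat_scheme \<Rightarrow> 'a \<Rightarrow> 'a \<Rightarrow> 'a \<Rightarrow> 'a \<Rightarrow> bool" where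
  "T_pullback C f g r0 r1 \<longleftrightarrow>
     (\<forall>k. is_pullback C ((TA C ^^ k) f) ((TA C ^^ k) g) ((TA C ^^ k) r0) ((TA C ^^ k) r1))"

definition T_product ::
  "('o, 'a, 'z) tancat_scheme \<Rightarrow> 'o \<Rightarrow> 'o \<Rightarrow> 'a \<Rightarrow> 'a \<Rightarrow> bool" where
  "T_product C A B r0 r1 \<longleftrightarrow>
     (\<forall>k. is_product C ((TO C ^^ k) A) ((TO C ^^ k) B) ((TA C ^^ k) r0) ((TA C ^^ k) r1))"

section \<open>Groupoids\<close>

text \<open>\<open>gfst\<close>, \<open>gsnd\<close> are the projections \<open>(g, h) \<mapsto> g\<close> and \<open>(g, h) \<mapsto> h\<close> of the pullback of
  composable pairs, \<open>s g = t h\<close>, on which the composition \<open>gcomp\<close> is defined.\<close>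

record ('o, 'a) groupoid =
  gbase :: 'o
  garr :: 'o
  gsrc :: 'a
  gtgt :: 'a
  gunit :: 'a
  ginv :: 'a
  gcomp :: 'a
  gfst :: 'a
  gsnd :: 'a

definition gmult ::
  "('o, 'a, 'z) cat_scheme \<Rightarrow> ('o, 'a) groupoid \<Rightarrow> 'a \<Rightarrow> 'a \<Rightarrow> 'a" where
  "gmult C \<G> g h = Comp C (gcomp \<G>) (pair C (gfst \<G>) (gsnd \<G>) g h)"

locale groupoid_in = tangent_category +
  fixes \<G> :: "('o, 'a) groupoid"
  assumes gbase: "gbase \<G> \<in> Obj C"
    and garr: "garr \<G> \<in> Obj C"
    and gsrc: "gsrc \<G> \<in> Hom C (garr \<G>) (gbase \<G>)"
    and gtgt: "gtgt \<G> \<in> Hom C (garr \<G>) (gbase \<G>)"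
    and gunit: "gunit \<G> \<in> Hom C (gbase \<G>) (garr \<G>)"
    and ginv: "ginv \<G> \<in> Hom C (garr \<G>) (garr \<G>)"
    and gcomp: "gcomp \<G> \<in> Hom C (Dom C (gfst \<G>)) (garr \<G>)"
    and composable_pairs: "T_pullback C (gsrc \<G>) (gtgt \<G>) (gfst \<G>) (gsnd \<G>)"
    and composable_triples: "\<exists>r0 r1. T_pullback C (gsnd \<G>) (gfst \<G>) r0 r1"
    and src_unit: "gsrc \<G> \<cdot> gunit \<G> = Id C (gbase \<G>)"
    and tgt_unit: "gtgt \<G> \<cdot> gunit \<G> = Id C (gbase \<G>)"
    and src_comp: "gsrc \<G> \<cdot> gcomp \<G> = gsrc \<G> \<cdot> gsnd \<G>"
    and tgt_comp: "gtgt \<G> \<cdot> gcomp \<G> = gtgt \<G> \<cdot> gfst \<G>"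
    and unit_right: "g \<in> Hom C X (garr \<G>) \<Longrightarrow> gmult C \<G> g (gunit \<G> \<cdot> gsrc \<G> \<cdot> g) = g"
    and unit_left: "g \<in> Hom C X (garr \<G>) \<Longrightarrow> gmult C \<G> (gunit \<G> \<cdot> gtgt \<G> \<cdot> g) g = g"
    and mult_assoc: "f \<in> Hom C X (garr \<G>) \<Longrightarrow> g \<in> Hom C X (garr \<G>) \<Longrightarrow> h \<in> Hom C X (garr \<G>) \<Longrightarrow>
          gsrc \<G> \<cdot> f = gtgt \<G> \<cdot> g \<Longrightarrow> gsrc \<G> \<cdot> g = gtgt \<G> \<cdot> h \<Longrightarrow>
          gmult C \<G> (gmult C \<G> f g) h = gmult C \<G> f (gmult C \<G> g h)"
    and src_inv: "gsrc \<G> \<cdot> ginv \<G> = gtgt \<G>"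
    and tgt_inv: "gtgt \<G> \<cdot> ginv \<G> = gsrc \<G>"
    and inv_right: "g \<in> Hom C X (garr \<G>) \<Longrightarrow>
          gmult C \<G> g (ginv \<G> \<cdot> g) = gunit \<G> \<cdot> gtgt \<G> \<cdot> g"
    and inv_left: "g \<in> Hom C X (garr \<G>) \<Longrightarrow>
          gmult C \<G> (ginv \<G> \<cdot> g) g = gunit \<G> \<cdot> gsrc \<G> \<cdot> g"

definition T_groupoid ::
  "('o, 'a, 'z) tancat_scheme \<Rightarrow> ('o, 'a) groupoid \<Rightarrow> ('o, 'a) groupoid" where
  "T_groupoid C \<G> =
     \<lparr>gbase = TO C (gbase \<G>), garr = TO C (garr \<G>), gsrc = TA C (gsrc \<G>), gtgt = TA C (gtgt \<G>),
      gunit = TA C (gunit \<G>), ginv = TA C (ginv \<G>), gcomp = TA C (gcomp \<G>),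
      gfst = TA C (gfst \<G>), gsnd = TA C (gsnd \<G>)\<rparr>"

section \<open>The associated anchored bundle and its prolongation\<close>

text \<open>\<open>A = Dom C \<iota>\<close> is the pullback of \<open>(p, T(s)) : T(G) \<rightarrow> G \<times> T(M)\<close> along
  \<open>(e, 0) : M \<rightarrow> G \<times> T(M)\<close>; here \<open>q0\<close>, \<open>q1\<close> are the projections of \<open>G \<times> T(M)\<close>.\<close>

definition associated_bundle ::
  "('o, 'a, 'z) tancat_scheme \<Rightarrow> ('o, 'a) groupoid \<Rightarrow> 'a \<Rightarrow> 'a \<Rightarrow> bool" where
  "associated_bundle C \<G> \<pi> \<iota> \<longleftrightarrow>
     (\<exists>q0 q1. T_product C (garr \<G>) (TO C (gbase \<G>)) q0 q1 \<and>
        T_pullback C (pair C q0 q1 (tp C (garr \<G>)) (TA C (gsrc \<G>)))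
          (pair C q0 q1 (gunit \<G>) (tzero C (gbase \<G>))) \<iota> \<pi>)"

definition zero_section ::
  "('o, 'a, 'z) tancat_scheme \<Rightarrow> ('o, 'a) groupoid \<Rightarrow> 'a \<Rightarrow> 'a" where
  "zero_section C \<G> \<iota> = lift_through C \<iota> (Comp C (tzero C (garr \<G>)) (gunit \<G>))"

definition bundle_lift ::
  "('o, 'a, 'z) tancat_scheme \<Rightarrow> ('o, 'a) groupoid \<Rightarrow> 'a \<Rightarrow> 'a" where
  "bundle_lift C \<G> \<iota> = lift_through C (TA C \<iota>) (Comp C (tl C (garr \<G>)) \<iota>)"

definition anchor ::
  "('o, 'a, 'z) tancat_scheme \<Rightarrow> ('o, 'a) groupoid \<Rightarrow> 'a \<Rightarrow> 'a" where
  "anchor C \<G> \<iota> = Comp C (TA C (gtgt \<G>)) \<iota>"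

definition prolongation ::
  "('o, 'a, 'z) tancat_scheme \<Rightarrow> ('o, 'a) groupoid \<Rightarrow> 'a \<Rightarrow> 'a \<Rightarrow> 'a \<Rightarrow> 'a \<Rightarrow> bool" where
  "prolongation C \<G> \<pi> \<iota> \<pi>0 \<pi>1 \<longleftrightarrow> T_pullback C (anchor C \<G> \<iota>) (TA C \<pi>) \<pi>0 \<pi>1"

text \<open>\<open>\<alpha>(v, w) = cw \<circ> 0v \<circ> (c0pw)\<inverse>\<close>, formed in \<open>T\<^sup>2(G)\<close> on the generic element \<open>(v, w)\<close> and
  then factored through \<open>T(\<iota>) : T(A) \<rightarrow> T\<^sup>2(G)\<close>.\<close>

definition alpha ::
  "('o, 'a, 'z) tancat_scheme \<Rightarrow> ('o, 'a) groupoid \<Rightarrow> 'a \<Rightarrow> 'a \<Rightarrow> 'a \<Rightarrow> 'a" where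
  "alpha C \<G> \<iota> \<pi>0 \<pi>1 =
     (let G = garr \<G>;
          \<G>2 = T_groupoid C (T_groupoid C \<G>);
          v = Comp C \<iota> \<pi>0;
          w = Comp C (TA C \<iota>) \<pi>1
      in lift_through C (TA C \<iota>)
           (gmult C \<G>2
             (gmult C \<G>2 (Comp C (tc C G) w) (Comp C (tzero C (TO C G)) v))
             (Comp C (ginv \<G>2)
               (Comp C (tc C G) (Comp C (tzero C (TO C G)) (Comp C (tp C (TO C G)) w))))))"

end

theory Submission
  imports Defs
begin

text \<open>
  Applying \<open>T\<close> to the groupoid \<open>G\<close> gives groupoids \<open>T(G)\<close> and \<open>T\<^sup>2(G)\<close> (\<open>groupoid_T\<close>), and by naturality
  \<open>c : T\<^sup>2(G) \<rightarrow> T\<^sup>2(G)\<close> and \<open>p, T(p) : T\<^sup>2(G) \<rightarrow> T(G)\<close> are functors (\<open>c_gmult\<close>, \<open>p_gmult\<close>, \<open>Tp_gmult\<close>).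
  All three equations can therefore be checked inside \<open>T\<^sup>2(G)\<close>, on generalised elements, because
  \<open>T(\<iota>)\<close> is a monomorphism. Put \<open>\<alpha> = \<alpha>(v, w) = cw \<circ> 0v \<circ> (c0pw)\<inverse>\<close>.

  The three factors are composable because \<open>cT(0) = 0\<close>, \<open>T(t)v = T(\<pi>)w\<close> and \<open>c00 = 00\<close>. The last one has source
  \<open>T\<^sup>2(t)(c0pw) = T(0)\<varrho>pw\<close>, and \<open>T(p)\<close> sends the composite to \<open>pw \<circ> 0pv \<circ> (pw)\<inverse>\<close>, which is the unit at
  \<open>\<varrho>pw\<close> because \<open>pv\<close> is a unit. Hence \<open>\<alpha>\<close> lies in \<open>T(A)\<close>, over \<open>\<varrho>pw\<close>; in particular \<open>(pw, \<alpha>)\<close> is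
  again an element of the prolongation.

  \<^item> If \<open>v = \<xi>\<pi>u\<close> and \<open>w = \<lambda>u\<close>, then \<open>0v\<close> and \<open>c0pw\<close> are units, and \<open>cw = w\<close> by \<open>cl = l\<close>
    (\<open>alpha_zero_lift\<close>).
  \<^item> The target of a composite is that of its first factor, so \<open>T\<^sup>2(t)\<alpha> = T\<^sup>2(t)cw = cT\<^sup>2(t)w\<close>
    (\<open>t_alpha\<close>).
  \<^item> Applying \<open>p\<close> and using \<open>pc = T(p)\<close> turns the outer factors into units, so \<open>p\<alpha> = v\<close> (\<open>p_alpha\<close>).
    Applying \<open>c\<close> and using \<open>cc = id\<close> gives \<open>c\<alpha> = w \<circ> c0v \<circ> (0pw)\<inverse>\<close>. Consequently
    \<open>\<alpha>(pw, \<alpha>) = w \<circ> c0v \<circ> (0pw)\<inverse> \<circ> 0pw \<circ> (c0v)\<inverse> = w\<close> (\<open>alpha_involution\<close>).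
\<close>

section \<open>Composition and limits on generalised elements\<close>

lemma Hom_iff: "f \<in> Hom C X Y \<longleftrightarrow> f \<in> Arr C \<and> Dom C f = X \<and> Cod C f = Y"
  by (simp add: Hom_def)

context cat
begin

lemma comp_arr [simp]:
  assumes "f \<in> Arr C" "g \<in> Arr C" "Dom C g = Cod C f"
  shows "g \<cdot> f \<in> Arr C" "Dom C (g \<cdot> f) = Dom C f" "Cod C (g \<cdot> f) = Cod C g"
  using Comp_Hom[of f "Dom C f" "Cod C f" g "Cod C g"] assms by (auto simp: Hom_iff)

lemma comp_assoc:
  assumes "f \<in> Arr C" "g \<in> Arr C" "h \<in> Arr C" "Dom C g = Cod C f" "Dom C h = Cod C g"
  shows "(h \<cdot> g) \<cdot> f = h \<cdot> (g \<cdot> f)"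
  using Comp_assoc[of f "Dom C f" "Cod C f" g "Cod C g" h "Cod C h"] assms by (auto simp: Hom_iff)

lemma Id_arr [simp]:
  assumes "X \<in> Obj C"
  shows "Id C X \<in> Arr C" "Dom C (Id C X) = X" "Cod C (Id C X) = X"
  using Id_Hom[OF assms] by (auto simp: Hom_iff)

lemma comp_id [simp]: "f \<in> Arr C \<Longrightarrow> Dom C f = X \<Longrightarrow> f \<cdot> Id C X = f"
  using Comp_Id by (auto simp: Hom_iff)

lemma id_comp [simp]: "f \<in> Arr C \<Longrightarrow> Cod C f = Y \<Longrightarrow> Id C Y \<cdot> f = f"
  using Id_Comp by (auto simp: Hom_iff)

lemma comp_reassoc:
  assumes "g \<cdot> f = k" "x \<in> Arr C" "f \<in> Arr C" "g \<in> Arr C" "Dom C f = Cod C x" "Dom C g = Cod C f"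
  shows "g \<cdot> (f \<cdot> x) = k \<cdot> x"
  using comp_assoc[of x f g] assms by simp

lemma comp_exchange:
  assumes "g \<cdot> f = g' \<cdot> f'" "x \<in> Arr C"
    and "f \<in> Arr C" "g \<in> Arr C" "Dom C f = Cod C x" "Dom C g = Cod C f"
    and "f' \<in> Arr C" "g' \<in> Arr C" "Dom C f' = Cod C x" "Dom C g' = Cod C f'"
  shows "g \<cdot> (f \<cdot> x) = g' \<cdot> (f' \<cdot> x)"
  using comp_assoc[of x f g] comp_assoc[of x f' g'] assms by simp

lemma is_pullback_arrD:
  assumes "is_pullback C f g r0 r1"
  shows "f \<in> Arr C" "g \<in> Arr C" "Cod C g = Cod C f" "r0 \<in> Arr C" "r1 \<in> Arr C"
    "Dom C r1 = Dom C r0" "Cod C r0 = Dom C f" "Cod C r1 = Dom C g" "f \<cdot> r0 = g \<cdot> r1"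
  using assms by (auto simp: is_pullback_def Hom_iff)

lemma is_pullback_ex1:
  assumes "is_pullback C f g r0 r1" "u \<in> Hom C X (Dom C f)" "v \<in> Hom C X (Dom C g)"
    and "f \<cdot> u = g \<cdot> v"
  shows "\<exists>!h. h \<in> Hom C X (Dom C r0) \<and> r0 \<cdot> h = u \<and> r1 \<cdot> h = v"
  using assms unfolding is_pullback_def by blast

lemma pullback_pair:
  assumes "is_pullback C f g r0 r1" "u \<in> Hom C X (Dom C f)" "v \<in> Hom C X (Dom C g)"
    and "f \<cdot> u = g \<cdot> v"
  shows "pair C r0 r1 u v \<in> Hom C X (Dom C r0)"
    "r0 \<cdot> pair C r0 r1 u v = u" "r1 \<cdot> pair C r0 r1 u v = v"
proof -
  have "Dom C u = X" using assms(2) by (simp add: Hom_iff)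
  with theI'[OF is_pullback_ex1[OF assms]]
  show "pair C r0 r1 u v \<in> Hom C X (Dom C r0)"
    "r0 \<cdot> pair C r0 r1 u v = u" "r1 \<cdot> pair C r0 r1 u v = v"
    by (simp_all add: pair_def)
qed

lemma pullback_eqI:
  assumes "is_pullback C f g r0 r1" "h \<in> Hom C X (Dom C r0)" "h' \<in> Hom C X (Dom C r0)"
    and "r0 \<cdot> h = r0 \<cdot> h'" "r1 \<cdot> h = r1 \<cdot> h'"
  shows "h = h'"
proof -
  note A = is_pullback_arrD[OF assms(1)]
  have "f \<cdot> (r0 \<cdot> h) = g \<cdot> (r1 \<cdot> h)"
    by (rule comp_exchange) (use A assms in \<open>auto simp: Hom_iff\<close>)
  moreover have "r0 \<cdot> h \<in> Hom C X (Dom C f)" "r1 \<cdot> h \<in> Hom C X (Dom C g)"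
    using A assms by (auto simp: Hom_iff)
  ultimately show ?thesis
    using is_pullback_ex1[OF assms(1), of "r0 \<cdot> h" X "r1 \<cdot> h"] assms by metis
qed

lemma pair_of_projections:
  assumes "is_pullback C f g r0 r1" "h \<in> Hom C X (Dom C r0)"
  shows "pair C r0 r1 (r0 \<cdot> h) (r1 \<cdot> h) = h"
proof -
  note A = is_pullback_arrD[OF assms(1)]
  have "f \<cdot> (r0 \<cdot> h) = g \<cdot> (r1 \<cdot> h)"
    by (rule comp_exchange) (use A assms in \<open>auto simp: Hom_iff\<close>)
  then have "pair C r0 r1 (r0 \<cdot> h) (r1 \<cdot> h) \<in> Hom C X (Dom C r0)"
    "r0 \<cdot> pair C r0 r1 (r0 \<cdot> h) (r1 \<cdot> h) = r0 \<cdot> h" "r1 \<cdot> pair C r0 r1 (r0 \<cdot> h) (r1 \<cdot> h) = r1 \<cdot> h"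
    using pullback_pair[OF assms(1), of "r0 \<cdot> h" X "r1 \<cdot> h"] A assms by (auto simp: Hom_iff)
  then show ?thesis
    using pullback_eqI[OF assms(1)] assms(2) by metis
qed

lemma product_pair:
  assumes "is_product C P Q r0 r1" "u \<in> Hom C X P" "v \<in> Hom C X Q"
  shows "pair C r0 r1 u v \<in> Hom C X (Dom C r0)"
    "r0 \<cdot> pair C r0 r1 u v = u" "r1 \<cdot> pair C r0 r1 u v = v"
proof -
  have "\<exists>!h. h \<in> Hom C X (Dom C r0) \<and> r0 \<cdot> h = u \<and> r1 \<cdot> h = v"
    using assms unfolding is_product_def by blast
  moreover have "Dom C u = X" using assms(2) by (simp add: Hom_iff)
  ultimately show "pair C r0 r1 u v \<in> Hom C X (Dom C r0)"
    "r0 \<cdot> pair C r0 r1 u v = u" "r1 \<cdot> pair C r0 r1 u v = v"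
    using theI'[of "\<lambda>h. h \<in> Hom C X (Dom C r0) \<and> r0 \<cdot> h = u \<and> r1 \<cdot> h = v"]
    by (simp_all add: pair_def)
qed

lemma product_eqI:
  assumes "is_product C P Q r0 r1" "h \<in> Hom C X (Dom C r0)" "h' \<in> Hom C X (Dom C r0)"
    and "r0 \<cdot> h = r0 \<cdot> h'" "r1 \<cdot> h = r1 \<cdot> h'"
  shows "h = h'"
proof -
  have "r0 \<cdot> h \<in> Hom C X P" "r1 \<cdot> h \<in> Hom C X Q"
    using assms(1,2) by (auto simp: is_product_def Hom_iff)
  then have "\<exists>!k. k \<in> Hom C X (Dom C r0) \<and> r0 \<cdot> k = r0 \<cdot> h \<and> r1 \<cdot> k = r1 \<cdot> h"
    using assms(1) unfolding is_product_def by blast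
  then show ?thesis using assms by metis
qed

lemma pullback_over_product:
  assumes prod: "is_product C P Q q0 q1" and pb: "is_pullback C f g r0 r1"
    and cod: "Cod C f = Dom C q0"
    and u: "u \<in> Hom C X (Dom C f)" and n: "n \<in> Hom C X (Dom C g)"
    and eq0: "(q0 \<cdot> f) \<cdot> u = (q0 \<cdot> g) \<cdot> n" and eq1: "(q1 \<cdot> f) \<cdot> u = (q1 \<cdot> g) \<cdot> n"
  shows "\<exists>h \<in> Hom C X (Dom C r0). r0 \<cdot> h = u \<and> r1 \<cdot> h = n"
proof -
  note A = is_pullback_arrD[OF pb]
  have Q: "q0 \<in> Arr C" "q1 \<in> Arr C" "Dom C q1 = Dom C q0"
    using prod by (auto simp: is_product_def Hom_iff)
  have "f \<cdot> u = g \<cdot> n"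
    by (rule product_eqI[OF prod, of _ X])
      (use A Q cod u n eq0 eq1 in \<open>auto simp: Hom_iff comp_assoc\<close>)
  then show ?thesis using is_pullback_ex1[OF pb u n] by blast
qed

text \<open>The pullback of a split monomorphism is a monomorphism.\<close>

lemma pullback_split_mono:
  assumes pb: "is_pullback C f g r0 r1" and r: "r \<in> Arr C" "Dom C r = Cod C g"
    and retract: "r \<cdot> g = Id C (Dom C g)"
    and h: "h \<in> Hom C X (Dom C r0)" and h': "h' \<in> Hom C X (Dom C r0)"
    and eq: "r0 \<cdot> h = r0 \<cdot> h'"
  shows "h = h'"
proof (rule pullback_eqI[OF pb h h' eq])
  note A = is_pullback_arrD[OF pb]
  have "r1 \<cdot> k = r \<cdot> (f \<cdot> (r0 \<cdot> k))" if "k \<in> Hom C X (Dom C r0)" for k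
  proof -
    have k: "k \<in> Arr C" "Dom C k = X" "Cod C k = Dom C r0" using that by (auto simp: Hom_iff)
    have "f \<cdot> (r0 \<cdot> k) = g \<cdot> (r1 \<cdot> k)" by (rule comp_exchange) (use A k in auto)
    moreover have "r \<cdot> (g \<cdot> (r1 \<cdot> k)) = Id C (Dom C g) \<cdot> (r1 \<cdot> k)"
      by (rule comp_reassoc[OF retract]) (use A k r in auto)
    ultimately show ?thesis using A k by simp
  qed
  from this[OF h] this[OF h'] eq show "r1 \<cdot> h = r1 \<cdot> h'" by simp
qed

lemma lift_through_eq:
  assumes "h \<in> Hom C X (Dom C m)" "m \<cdot> h = u" "Dom C u = X"
    and mono: "\<And>k k'. k \<in> Hom C X (Dom C m) \<Longrightarrow> k' \<in> Hom C X (Dom C m) \<Longrightarrow> m \<cdot> k = m \<cdot> k' \<Longrightarrow> k = k'"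
  shows "lift_through C m u = h"
  unfolding lift_through_def
proof (rule the_equality)
  show "h \<in> Hom C (Dom C u) (Dom C m) \<and> m \<cdot> h = u" using assms(1-3) by simp
next
  fix k assume "k \<in> Hom C (Dom C u) (Dom C m) \<and> m \<cdot> k = u"
  then show "k = h" using assms(1-3) by (auto intro: mono[of k h])
qed

end

section \<open>Multiplication of generalised elements\<close>

text \<open>The part of the groupoid structure that is needed in order to multiply generalised
  elements: source, target, and a composition defined on a pullback of composable pairs.\<close>

locale composition_structure = cat C
  for C :: "('o, 'a, 'z) cat_scheme" (structure) +
  fixes \<G> :: "('o, 'a) groupoid"
  assumes src_Hom: "gsrc \<G> \<in> Hom C (garr \<G>) (gbase \<G>)"
    and tgt_Hom: "gtgt \<G> \<in> Hom C (garr \<G>) (gbase \<G>)"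
    and comp_Hom: "gcomp \<G> \<in> Hom C (Dom C (gfst \<G>)) (garr \<G>)"
    and pairs: "is_pullback C (gsrc \<G>) (gtgt \<G>) (gfst \<G>) (gsnd \<G>)"
    and source_comp: "gsrc \<G> \<cdot> gcomp \<G> = gsrc \<G> \<cdot> gsnd \<G>"
    and target_comp: "gtgt \<G> \<cdot> gcomp \<G> = gtgt \<G> \<cdot> gfst \<G>"
begin

lemma graph_arr [simp]:
  "gsrc \<G> \<in> Arr C" "Dom C (gsrc \<G>) = garr \<G>" "Cod C (gsrc \<G>) = gbase \<G>"
  "gtgt \<G> \<in> Arr C" "Dom C (gtgt \<G>) = garr \<G>" "Cod C (gtgt \<G>) = gbase \<G>"
  "gcomp \<G> \<in> Arr C" "Dom C (gcomp \<G>) = Dom C (gfst \<G>)" "Cod C (gcomp \<G>) = garr \<G>"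
  "gfst \<G> \<in> Arr C" "Cod C (gfst \<G>) = garr \<G>"
  "gsnd \<G> \<in> Arr C" "Dom C (gsnd \<G>) = Dom C (gfst \<G>)" "Cod C (gsnd \<G>) = garr \<G>"
  using src_Hom tgt_Hom comp_Hom is_pullback_arrD[OF pairs] by (auto simp: Hom_iff)

lemma composable_pair:
  assumes "g \<in> Arr C" "Cod C g = garr \<G>" "h \<in> Arr C" "Cod C h = garr \<G>" "Dom C g = Dom C h"
    and "gsrc \<G> \<cdot> g = gtgt \<G> \<cdot> h"
  shows "pair C (gfst \<G>) (gsnd \<G>) g h \<in> Arr C"
    "Dom C (pair C (gfst \<G>) (gsnd \<G>) g h) = Dom C h"
    "Cod C (pair C (gfst \<G>) (gsnd \<G>) g h) = Dom C (gfst \<G>)"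
    "gfst \<G> \<cdot> pair C (gfst \<G>) (gsnd \<G>) g h = g" "gsnd \<G> \<cdot> pair C (gfst \<G>) (gsnd \<G>) g h = h"
  using pullback_pair[OF pairs, of g "Dom C h" h] assms by (auto simp: Hom_iff)

lemma gmult_arr [simp]:
  assumes "g \<in> Arr C" "Cod C g = garr \<G>" "h \<in> Arr C" "Cod C h = garr \<G>" "Dom C g = Dom C h"
    and "gsrc \<G> \<cdot> g = gtgt \<G> \<cdot> h"
  shows "gmult C \<G> g h \<in> Arr C" "Dom C (gmult C \<G> g h) = Dom C h" "Cod C (gmult C \<G> g h) = garr \<G>"
  using composable_pair[OF assms] by (simp_all add: gmult_def)

lemma gmult_src [simp]:
  assumes "g \<in> Arr C" "Cod C g = garr \<G>" "h \<in> Arr C" "Cod C h = garr \<G>" "Dom C g = Dom C h"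
    and "gsrc \<G> \<cdot> g = gtgt \<G> \<cdot> h"
  shows "gsrc \<G> \<cdot> gmult C \<G> g h = gsrc \<G> \<cdot> h"
proof -
  let ?k = "pair C (gfst \<G>) (gsnd \<G>) g h"
  note k = composable_pair[OF assms]
  have "gsrc \<G> \<cdot> (gcomp \<G> \<cdot> ?k) = gsrc \<G> \<cdot> (gsnd \<G> \<cdot> ?k)"
    by (rule comp_exchange[OF source_comp]) (simp_all add: k)
  then show ?thesis by (simp only: gmult_def k)
qed

lemma gmult_tgt [simp]:
  assumes "g \<in> Arr C" "Cod C g = garr \<G>" "h \<in> Arr C" "Cod C h = garr \<G>" "Dom C g = Dom C h"
    and "gsrc \<G> \<cdot> g = gtgt \<G> \<cdot> h"
  shows "gtgt \<G> \<cdot> gmult C \<G> g h = gtgt \<G> \<cdot> g"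
proof -
  let ?k = "pair C (gfst \<G>) (gsnd \<G>) g h"
  note k = composable_pair[OF assms]
  have "gtgt \<G> \<cdot> (gcomp \<G> \<cdot> ?k) = gtgt \<G> \<cdot> (gfst \<G> \<cdot> ?k)"
    by (rule comp_exchange[OF target_comp]) (simp_all add: k)
  then show ?thesis by (simp only: gmult_def k)
qed

end

text \<open>An arrow between arrow objects respects multiplication as soon as it is covered by an
  arrow between the objects of composable pairs.\<close>

lemma gmult_map:
  assumes "composition_structure C \<G>" "composition_structure C \<H>"
    and \<phi>: "\<phi> \<in> Hom C (garr \<G>) (garr \<H>)"
    and \<psi>: "\<psi> \<in> Hom C (Dom C (gfst \<G>)) (Dom C (gfst \<H>))"
    and "fst": "Comp C (gfst \<H>) \<psi> = Comp C \<phi> (gfst \<G>)"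
    and "snd": "Comp C (gsnd \<H>) \<psi> = Comp C \<phi> (gsnd \<G>)"
    and comp: "Comp C (gcomp \<H>) \<psi> = Comp C \<phi> (gcomp \<G>)"
    and g: "g \<in> Arr C" "Cod C g = garr \<G>" "h \<in> Arr C" "Cod C h = garr \<G>" "Dom C g = Dom C h"
    and gh: "Comp C (gsrc \<G>) g = Comp C (gtgt \<G>) h"
  shows "Comp C \<phi> (gmult C \<G> g h) = gmult C \<H> (Comp C \<phi> g) (Comp C \<phi> h)"
proof -
  interpret G: composition_structure C \<G> by fact
  interpret H: composition_structure C \<H> by fact
  let ?k = "pair C (gfst \<G>) (gsnd \<G>) g h"
  note k = G.composable_pair[OF g gh]
  note arr = \<phi>[unfolded Hom_iff] \<psi>[unfolded Hom_iff]
  have "Comp C (gfst \<H>) (Comp C \<psi> ?k) = Comp C \<phi> (Comp C (gfst \<G>) ?k)"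
    by (rule G.comp_exchange[OF "fst"]) (use arr k in auto)
  moreover have "Comp C (gsnd \<H>) (Comp C \<psi> ?k) = Comp C \<phi> (Comp C (gsnd \<G>) ?k)"
    by (rule G.comp_exchange[OF "snd"]) (use arr k in auto)
  moreover have "Comp C (gcomp \<H>) (Comp C \<psi> ?k) = Comp C \<phi> (Comp C (gcomp \<G>) ?k)"
    by (rule G.comp_exchange[OF comp]) (use arr k in auto)
  moreover have "pair C (gfst \<H>) (gsnd \<H>) (Comp C (gfst \<H>) (Comp C \<psi> ?k))
      (Comp C (gsnd \<H>) (Comp C \<psi> ?k)) = Comp C \<psi> ?k"
    by (rule G.pair_of_projections[OF H.pairs, of _ "Dom C h"]) (use arr k in \<open>auto simp: Hom_iff\<close>)
  ultimately show ?thesis using k by (simp add: gmult_def)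
qed

context composition_structure
begin

lemma gmult_precomp:
  assumes g: "g \<in> Arr C" "Cod C g = garr \<G>" "h \<in> Arr C" "Cod C h = garr \<G>" "Dom C g = Dom C h"
    and gh: "gsrc \<G> \<cdot> g = gtgt \<G> \<cdot> h" and k: "k \<in> Arr C" "Cod C k = Dom C h"
  shows "gmult C \<G> g h \<cdot> k = gmult C \<G> (g \<cdot> k) (h \<cdot> k)"
proof -
  let ?p = "pair C (gfst \<G>) (gsnd \<G>) g h"
  note p = composable_pair[OF g gh]
  have "gfst \<G> \<cdot> (?p \<cdot> k) = g \<cdot> k" "gsnd \<G> \<cdot> (?p \<cdot> k) = h \<cdot> k"
    by (rule comp_reassoc; use p k in simp)+
  with pair_of_projections[OF pairs, of "?p \<cdot> k" "Dom C k"]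
  have "pair C (gfst \<G>) (gsnd \<G>) (g \<cdot> k) (h \<cdot> k) = ?p \<cdot> k"
    using p k by (simp add: Hom_iff)
  then show ?thesis using p k by (simp add: gmult_def comp_assoc)
qed

end

section \<open>Structural identities on generalised elements\<close>

context tangent_category
begin

lemma TO_obj [simp]: "X \<in> Obj C \<Longrightarrow> TO C X \<in> Obj C"
  by (rule TO_Obj)

lemma arr_obj [simp]: "f \<in> Arr C \<Longrightarrow> Dom C f \<in> Obj C" "f \<in> Arr C \<Longrightarrow> Cod C f \<in> Obj C"
  by (simp_all add: Dom_Obj Cod_Obj)

lemma TA_arr [simp]:
  assumes "f \<in> Arr C"
  shows "TA C f \<in> Arr C" "Dom C (TA C f) = TO C (Dom C f)" "Cod C (TA C f) = TO C (Cod C f)"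
  using TA_Hom[of f "Dom C f" "Cod C f"] assms by (simp_all add: Hom_iff)

lemma TA_comp:
  assumes "f \<in> Arr C" "g \<in> Arr C" "Dom C g = Cod C f"
  shows "TA C (g \<cdot> f) = TA C g \<cdot> TA C f"
  using TA_Comp[of f "Dom C f" "Cod C f" g "Cod C g"] assms by (simp add: Hom_iff)

lemma structure_arr [simp]:
  assumes "X \<in> Obj C"
  shows "tp C X \<in> Arr C" "Dom C (tp C X) = TO C X" "Cod C (tp C X) = X"
    "tzero C X \<in> Arr C" "Dom C (tzero C X) = X" "Cod C (tzero C X) = TO C X"
    "tl C X \<in> Arr C" "Dom C (tl C X) = TO C X" "Cod C (tl C X) = TO C (TO C X)"
    "tc C X \<in> Arr C" "Dom C (tc C X) = TO C (TO C X)" "Cod C (tc C X) = TO C (TO C X)"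
  using tp_Hom[OF assms] tzero_Hom[OF assms] tl_Hom[OF assms] tc_Hom[OF assms]
  by (simp_all add: Hom_iff)

lemma c_c:
  assumes "X \<in> Obj C" "x \<in> Arr C" "Cod C x = TO C (TO C X)"
  shows "tc C X \<cdot> (tc C X \<cdot> x) = x"
  using comp_reassoc[OF tc_tc[OF assms(1)] assms(2)] assms by simp

lemma p_0:
  assumes "X \<in> Obj C" "x \<in> Arr C" "Cod C x = X"
  shows "tp C X \<cdot> (tzero C X \<cdot> x) = x"
proof -
  have "tp C X \<cdot> tzero C X = Id C X"
    using additive_bundle.proj_zero[OF tangent_additive[OF assms(1)]] assms(1)
    by (simp add: tangent_bundle_def)
  from comp_reassoc[OF this assms(2)] show ?thesis using assms by simp
qed

lemma p_c:
  assumes "X \<in> Obj C" "x \<in> Arr C" "Cod C x = TO C (TO C X)"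
  shows "tp C (TO C X) \<cdot> (tc C X \<cdot> x) = TA C (tp C X) \<cdot> x"
proof -
  have "tp C (TO C X) \<cdot> tc C X = TA C (tp C X)"
    using tc_additive[OF assms(1)] assms(1)
    by (simp add: additive_bundle_morphism_def tangent_bundle_def T_bundle_def)
  from comp_reassoc[OF this assms(2)] show ?thesis using assms by simp
qed

lemma Tp_c:
  assumes "X \<in> Obj C" "x \<in> Arr C" "Cod C x = TO C (TO C X)"
  shows "TA C (tp C X) \<cdot> (tc C X \<cdot> x) = tp C (TO C X) \<cdot> x"
  using p_c[of X "tc C X \<cdot> x"] assms by (simp add: c_c)

lemma c_T0:
  assumes "X \<in> Obj C" "x \<in> Arr C" "Cod C x = TO C X"
  shows "tc C X \<cdot> (TA C (tzero C X) \<cdot> x) = tzero C (TO C X) \<cdot> x"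
proof -
  have "tc C X \<cdot> TA C (tzero C X) = tzero C (TO C X)"
    using tc_additive[OF assms(1)] assms(1)
    by (simp add: additive_bundle_morphism_def tangent_bundle_def T_bundle_def)
  from comp_reassoc[OF this assms(2)] show ?thesis using assms by simp
qed

lemma c_0:
  assumes "X \<in> Obj C" "x \<in> Arr C" "Cod C x = TO C X"
  shows "tc C X \<cdot> (tzero C (TO C X) \<cdot> x) = TA C (tzero C X) \<cdot> x"
  using c_T0[OF assms, symmetric] assms by (simp add: c_c)

lemma c_l:
  assumes "X \<in> Obj C" "x \<in> Arr C" "Cod C x = TO C X"
  shows "tc C X \<cdot> (tl C X \<cdot> x) = tl C X \<cdot> x"
  using comp_reassoc[OF tc_tl[OF assms(1)] assms(2)] assms by simp

lemma Tp_l: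
  assumes "X \<in> Obj C" "x \<in> Arr C" "Cod C x = TO C X"
  shows "TA C (tp C X) \<cdot> (tl C X \<cdot> x) = tzero C X \<cdot> (tp C X \<cdot> x)"
proof -
  have "TA C (tp C X) \<cdot> tl C X = tzero C X \<cdot> tp C X"
    using tl_additive[OF assms(1)]
    by (simp add: additive_bundle_morphism_def tangent_bundle_def T_bundle_def)
  from comp_exchange[OF this assms(2)] show ?thesis using assms by simp
qed

lemma p_l:
  assumes "X \<in> Obj C" "x \<in> Arr C" "Cod C x = TO C X"
  shows "tp C (TO C X) \<cdot> (tl C X \<cdot> x) = tzero C X \<cdot> (tp C X \<cdot> x)"
  using p_c[of X "tl C X \<cdot> x"] assms by (simp add: c_l Tp_l)

lemma l_0:
  assumes "X \<in> Obj C" "x \<in> Arr C" "Cod C x = X"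
  shows "tl C X \<cdot> (tzero C X \<cdot> x) = TA C (tzero C X) \<cdot> (tzero C X \<cdot> x)"
proof -
  have "tl C X \<cdot> tzero C X = TA C (tzero C X) \<cdot> tzero C X"
    using tl_additive[OF assms(1)]
    by (simp add: additive_bundle_morphism_def tangent_bundle_def T_bundle_def)
  from comp_exchange[OF this assms(2)] show ?thesis using assms by simp
qed

lemma p_nat:
  assumes "f \<in> Arr C" "Cod C f = Y" "x \<in> Arr C" "Cod C x = TO C (Dom C f)"
  shows "tp C Y \<cdot> (TA C f \<cdot> x) = f \<cdot> (tp C (Dom C f) \<cdot> x)"
  by (rule comp_exchange[OF tp_nat[of f "Dom C f" Y] assms(3)]) (use assms in \<open>auto simp: Hom_iff\<close>)

lemma zero_nat:
  assumes "f \<in> Arr C" "Cod C f = Y" "x \<in> Arr C" "Cod C x = Dom C f"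
  shows "tzero C Y \<cdot> (f \<cdot> x) = TA C f \<cdot> (tzero C (Dom C f) \<cdot> x)"
  by (rule comp_exchange[OF tzero_nat[of f "Dom C f" Y] assms(3)]) (use assms in \<open>auto simp: Hom_iff\<close>)

lemma l_nat:
  assumes "f \<in> Arr C" "Cod C f = Y" "x \<in> Arr C" "Cod C x = TO C (Dom C f)"
  shows "tl C Y \<cdot> (TA C f \<cdot> x) = TA C (TA C f) \<cdot> (tl C (Dom C f) \<cdot> x)"
  by (rule comp_exchange[OF tl_nat[of f "Dom C f" Y] assms(3)]) (use assms in \<open>auto simp: Hom_iff\<close>)

lemma c_nat:
  assumes "f \<in> Arr C" "Cod C f = Y" "x \<in> Arr C" "Cod C x = TO C (TO C (Dom C f))"
  shows "tc C Y \<cdot> (TA C (TA C f) \<cdot> x) = TA C (TA C f) \<cdot> (tc C (Dom C f) \<cdot> x)"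
  by (rule comp_exchange[OF tc_nat[of f "Dom C f" Y] assms(3)]) (use assms in \<open>auto simp: Hom_iff\<close>)

end

section \<open>The tangent groupoid\<close>

lemma T_groupoid_sel [simp]:
  "gbase (T_groupoid C \<G>) = TO C (gbase \<G>)" "garr (T_groupoid C \<G>) = TO C (garr \<G>)"
  "gsrc (T_groupoid C \<G>) = TA C (gsrc \<G>)" "gtgt (T_groupoid C \<G>) = TA C (gtgt \<G>)"
  "gunit (T_groupoid C \<G>) = TA C (gunit \<G>)" "ginv (T_groupoid C \<G>) = TA C (ginv \<G>)"
  "gcomp (T_groupoid C \<G>) = TA C (gcomp \<G>)" "gfst (T_groupoid C \<G>) = TA C (gfst \<G>)"
  "gsnd (T_groupoid C \<G>) = TA C (gsnd \<G>)"
  by (simp_all add: T_groupoid_def)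

lemma T_pullbackD:
  assumes "T_pullback C f g r0 r1"
  shows "is_pullback C f g r0 r1" "is_pullback C (TA C f) (TA C g) (TA C r0) (TA C r1)"
    "T_pullback C (TA C f) (TA C g) (TA C r0) (TA C r1)"
proof -
  have pb: "is_pullback C ((TA C ^^ k) f) ((TA C ^^ k) g) ((TA C ^^ k) r0) ((TA C ^^ k) r1)" for k
    using assms by (simp add: T_pullback_def)
  from pb[of 0] show "is_pullback C f g r0 r1" by simp
  from pb[of 1] show "is_pullback C (TA C f) (TA C g) (TA C r0) (TA C r1)" by simp
  show "T_pullback C (TA C f) (TA C g) (TA C r0) (TA C r1)"
    unfolding T_pullback_def
  proof
    fix k
    from pb[of "Suc k"]
    show "is_pullback C ((TA C ^^ k) (TA C f)) ((TA C ^^ k) (TA C g))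
        ((TA C ^^ k) (TA C r0)) ((TA C ^^ k) (TA C r1))"
      by (simp add: funpow_swap1)
  qed
qed

sublocale groupoid_in \<subseteq> composition_structure C \<G>
  by unfold_locales
    (use gsrc gtgt gcomp T_pullbackD(1)[OF composable_pairs] src_comp tgt_comp in auto)

context groupoid_in
begin

lemma groupoid_arr [simp]:
  "gbase \<G> \<in> Obj C" "garr \<G> \<in> Obj C"
  "gunit \<G> \<in> Arr C" "Dom C (gunit \<G>) = gbase \<G>" "Cod C (gunit \<G>) = garr \<G>"
  "ginv \<G> \<in> Arr C" "Dom C (ginv \<G>) = garr \<G>" "Cod C (ginv \<G>) = garr \<G>"
  using gbase garr gunit ginv by (simp_all add: Hom_iff)

lemma src_unit_el [simp]: "x \<in> Arr C \<Longrightarrow> Cod C x = gbase \<G> \<Longrightarrow> gsrc \<G> \<cdot> (gunit \<G> \<cdot> x) = x"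
  using comp_reassoc[OF src_unit] by simp

lemma tgt_unit_el [simp]: "x \<in> Arr C \<Longrightarrow> Cod C x = gbase \<G> \<Longrightarrow> gtgt \<G> \<cdot> (gunit \<G> \<cdot> x) = x"
  using comp_reassoc[OF tgt_unit] by simp

lemma src_inv_el [simp]:
  "x \<in> Arr C \<Longrightarrow> Cod C x = garr \<G> \<Longrightarrow> gsrc \<G> \<cdot> (ginv \<G> \<cdot> x) = gtgt \<G> \<cdot> x"
  using comp_reassoc[OF src_inv] by simp

lemma tgt_inv_el [simp]:
  "x \<in> Arr C \<Longrightarrow> Cod C x = garr \<G> \<Longrightarrow> gtgt \<G> \<cdot> (ginv \<G> \<cdot> x) = gsrc \<G> \<cdot> x"
  using comp_reassoc[OF tgt_inv] by simp

lemma mult_unit: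
  "g \<in> Arr C \<Longrightarrow> Cod C g = garr \<G> \<Longrightarrow> gsrc \<G> \<cdot> g = x \<Longrightarrow> gmult C \<G> g (gunit \<G> \<cdot> x) = g"
  using unit_right[of g "Dom C g"] by (auto simp: Hom_iff)

lemma unit_mult:
  "g \<in> Arr C \<Longrightarrow> Cod C g = garr \<G> \<Longrightarrow> gtgt \<G> \<cdot> g = x \<Longrightarrow> gmult C \<G> (gunit \<G> \<cdot> x) g = g"
  using unit_left[of g "Dom C g"] by (auto simp: Hom_iff)

lemma mult_inv_cancel:
  assumes "g \<in> Arr C" "Cod C g = garr \<G>" "h \<in> Arr C" "Cod C h = garr \<G>" "Dom C g = Dom C h"
    and "gsrc \<G> \<cdot> g = gtgt \<G> \<cdot> h"
  shows "gmult C \<G> (gmult C \<G> g h) (ginv \<G> \<cdot> h) = g"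
  using mult_assoc[of g "Dom C h" h "ginv \<G> \<cdot> h"] inv_right[of h "Dom C h"] mult_unit[of g] assms
  by (simp add: Hom_iff)

lemma inv_mult_cancel:
  assumes "g \<in> Arr C" "Cod C g = garr \<G>" "h \<in> Arr C" "Cod C h = garr \<G>" "Dom C g = Dom C h"
    and "gsrc \<G> \<cdot> g = gsrc \<G> \<cdot> h"
  shows "gmult C \<G> (gmult C \<G> g (ginv \<G> \<cdot> h)) h = g"
  using mult_assoc[of g "Dom C h" "ginv \<G> \<cdot> h" h] inv_left[of h "Dom C h"] mult_unit[of g] assms
  by (simp add: Hom_iff)

lemma mult_inv_unit:
  assumes "g \<in> Arr C" "Cod C g = garr \<G>" "gsrc \<G> \<cdot> g = x" "x \<in> Arr C" "Cod C x = gbase \<G>"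
    "Dom C x = Dom C g"
  shows "gmult C \<G> g (ginv \<G> \<cdot> (gunit \<G> \<cdot> x)) = g"
  using mult_inv_cancel[of g "gunit \<G> \<cdot> x"] mult_unit[of g x] assms by simp

lemma mult_inv_self:
  assumes "g \<in> Arr C" "Cod C g = garr \<G>"
  shows "gmult C \<G> g (ginv \<G> \<cdot> g) = gunit \<G> \<cdot> (gtgt \<G> \<cdot> g)"
  using inv_right[of g "Dom C g"] assms by (simp add: Hom_iff)

lemma composition_structure_T: "composition_structure C (T_groupoid C \<G>)"
proof unfold_locales
  show "is_pullback C (gsrc (T_groupoid C \<G>)) (gtgt (T_groupoid C \<G>))
      (gfst (T_groupoid C \<G>)) (gsnd (T_groupoid C \<G>))"
    using T_pullbackD(2)[OF composable_pairs] by simp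
  show "gsrc (T_groupoid C \<G>) \<cdot> gcomp (T_groupoid C \<G>) = gsrc (T_groupoid C \<G>) \<cdot> gsnd (T_groupoid C \<G>)"
    using src_comp by (simp flip: TA_comp)
  show "gtgt (T_groupoid C \<G>) \<cdot> gcomp (T_groupoid C \<G>) = gtgt (T_groupoid C \<G>) \<cdot> gfst (T_groupoid C \<G>)"
    using tgt_comp by (simp flip: TA_comp)
qed (simp_all add: Hom_iff)

lemma TA_gmult:
  assumes "g \<in> Arr C" "Cod C g = garr \<G>" "h \<in> Arr C" "Cod C h = garr \<G>" "Dom C g = Dom C h"
    and "gsrc \<G> \<cdot> g = gtgt \<G> \<cdot> h"
  shows "TA C (gmult C \<G> g h) = gmult C (T_groupoid C \<G>) (TA C g) (TA C h)"
proof -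
  interpret T: composition_structure C "T_groupoid C \<G>" by (rule composition_structure_T)
  let ?k = "pair C (gfst \<G>) (gsnd \<G>) g h"
  note k = composable_pair[OF assms]
  have "TA C (gfst \<G>) \<cdot> TA C ?k = TA C g" "TA C (gsnd \<G>) \<cdot> TA C ?k = TA C h"
    using k by (simp_all flip: TA_comp)
  moreover have "pair C (gfst (T_groupoid C \<G>)) (gsnd (T_groupoid C \<G>))
      (gfst (T_groupoid C \<G>) \<cdot> TA C ?k) (gsnd (T_groupoid C \<G>) \<cdot> TA C ?k) = TA C ?k"
    by (rule pair_of_projections[OF T.pairs, of _ "TO C (Dom C h)"]) (simp add: Hom_iff k)
  ultimately show ?thesis using k by (simp add: gmult_def TA_comp)
qed

text \<open>The groupoid equations, stated for all generalised elements, are equations between arrows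
  out of \<open>G\<close> or out of the object of composable triples. Applying \<open>T\<close> to these universal instances
  gives the equations for \<open>T(G)\<close>, because \<open>T\<close> preserves the two pullbacks.\<close>

lemma groupoid_T: "groupoid_in C (T_groupoid C \<G>)"
proof -
  let ?T = "T_groupoid C \<G>"
  interpret T: composition_structure C ?T by (rule composition_structure_T)
  have id: "g \<in> Arr C \<Longrightarrow> Cod C g = TO C (garr \<G>) \<Longrightarrow> TA C (Id C (garr \<G>)) \<cdot> g = g" for g
    by (simp add: TA_Id)
  have precomp: "gmult C ?T (TA C a) (TA C b) \<cdot> g = gmult C ?T (TA C a \<cdot> g) (TA C b \<cdot> g)"
    if "a \<in> Arr C" "Dom C a = garr \<G>" "Cod C a = garr \<G>" "b \<in> Arr C" "Dom C b = garr \<G>"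
      "Cod C b = garr \<G>" "gsrc \<G> \<cdot> a = gtgt \<G> \<cdot> b" "g \<in> Arr C" "Cod C g = TO C (garr \<G>)" for a b g
    by (rule T.gmult_precomp) (use that in \<open>simp_all flip: TA_comp\<close>)
  have unitR: "gmult C ?T g (gunit ?T \<cdot> gsrc ?T \<cdot> g) = g"
    if "g \<in> Hom C X (garr ?T)" for g X
  proof -
    have "TA C (gmult C \<G> (Id C (garr \<G>)) (gunit \<G> \<cdot> gsrc \<G>)) \<cdot> g = TA C (Id C (garr \<G>)) \<cdot> g"
      using unit_right[of "Id C (garr \<G>)" "garr \<G>"] by (simp add: Hom_iff)
    then show ?thesis using that
      by (simp add: TA_gmult precomp id Hom_iff) (simp add: TA_comp comp_assoc)
  qed
  have unitL: "gmult C ?T (gunit ?T \<cdot> gtgt ?T \<cdot> g) g = g"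
    if "g \<in> Hom C X (garr ?T)" for g X
  proof -
    have "TA C (gmult C \<G> (gunit \<G> \<cdot> gtgt \<G>) (Id C (garr \<G>))) \<cdot> g = TA C (Id C (garr \<G>)) \<cdot> g"
      using unit_left[of "Id C (garr \<G>)" "garr \<G>"] by (simp add: Hom_iff)
    then show ?thesis using that
      by (simp add: TA_gmult precomp id Hom_iff) (simp add: TA_comp comp_assoc)
  qed
  have invR: "gmult C ?T g (ginv ?T \<cdot> g) = gunit ?T \<cdot> gtgt ?T \<cdot> g"
    if "g \<in> Hom C X (garr ?T)" for g X
  proof -
    have "TA C (gmult C \<G> (Id C (garr \<G>)) (ginv \<G>)) \<cdot> g = TA C (gunit \<G> \<cdot> gtgt \<G>) \<cdot> g"
      using inv_right[of "Id C (garr \<G>)" "garr \<G>"] by (simp add: Hom_iff)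
    then show ?thesis using that tgt_inv
      by (simp add: TA_gmult precomp id Hom_iff) (simp add: TA_comp comp_assoc)
  qed
  have invL: "gmult C ?T (ginv ?T \<cdot> g) g = gunit ?T \<cdot> gsrc ?T \<cdot> g"
    if "g \<in> Hom C X (garr ?T)" for g X
  proof -
    have "TA C (gmult C \<G> (ginv \<G>) (Id C (garr \<G>))) \<cdot> g = TA C (gunit \<G> \<cdot> gsrc \<G>) \<cdot> g"
      using inv_left[of "Id C (garr \<G>)" "garr \<G>"] by (simp add: Hom_iff)
    then show ?thesis using that src_inv
      by (simp add: TA_gmult precomp id Hom_iff) (simp add: TA_comp comp_assoc)
  qed
  have assoc: "gmult C ?T (gmult C ?T f g) h = gmult C ?T f (gmult C ?T g h)"
    if "f \<in> Hom C X (garr ?T)" "g \<in> Hom C X (garr ?T)" "h \<in> Hom C X (garr ?T)"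
      and fg: "gsrc ?T \<cdot> f = gtgt ?T \<cdot> g" and gh: "gsrc ?T \<cdot> g = gtgt ?T \<cdot> h" for f g h X
  proof -
    have el: "f \<in> Arr C" "Dom C f = X" "Cod C f = garr ?T" "g \<in> Arr C" "Dom C g = X"
      "Cod C g = garr ?T" "h \<in> Arr C" "Dom C h = X" "Cod C h = garr ?T"
      using that by (simp_all add: Hom_iff)
    obtain r0 r1 where triples: "T_pullback C (gsnd \<G>) (gfst \<G>) r0 r1"
      using composable_triples by blast
    note r = is_pullback_arrD[OF T_pullbackD(1)[OF triples]]
    \<comment> \<open>\<open>a\<close>, \<open>b\<close>, \<open>c\<close> are the three components of the universal composable triple.\<close>
    define a b c where abc: "a = gfst \<G> \<cdot> r0" "b = gsnd \<G> \<cdot> r0" "c = gsnd \<G> \<cdot> r1"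
    have arr: "a \<in> Arr C" "Dom C a = Dom C r0" "Cod C a = garr \<G>"
      "b \<in> Arr C" "Dom C b = Dom C r0" "Cod C b = garr \<G>"
      "c \<in> Arr C" "Dom C c = Dom C r0" "Cod C c = garr \<G>"
      using r by (simp_all add: abc)
    have ab: "gsrc \<G> \<cdot> a = gtgt \<G> \<cdot> b"
      unfolding abc by (rule comp_exchange[OF is_pullback_arrD(9)[OF pairs]]) (use r in simp_all)
    have bc: "gsrc \<G> \<cdot> b = gtgt \<G> \<cdot> c"
      unfolding abc r(9) by (rule comp_exchange[OF is_pullback_arrD(9)[OF pairs]]) (use r in simp_all)
    have univ: "TA C (gmult C \<G> (gmult C \<G> a b) c) = TA C (gmult C \<G> a (gmult C \<G> b c))"
      using mult_assoc[of a "Dom C r0" b c] arr ab bc by (simp add: Hom_iff)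
    define u v where uv: "u = pair C (gfst ?T) (gsnd ?T) f g" "v = pair C (gfst ?T) (gsnd ?T) g h"
    have u: "u \<in> Arr C" "Dom C u = X" "Cod C u = TO C (Dom C (gfst \<G>))"
      "TA C (gfst \<G>) \<cdot> u = f" "TA C (gsnd \<G>) \<cdot> u = g"
      using T.composable_pair[OF _ _ _ _ _ fg] el unfolding uv by simp_all
    have v: "v \<in> Arr C" "Dom C v = X" "Cod C v = TO C (Dom C (gfst \<G>))"
      "TA C (gfst \<G>) \<cdot> v = g" "TA C (gsnd \<G>) \<cdot> v = h"
      using T.composable_pair[OF _ _ _ _ _ gh] el unfolding uv by simp_all
    define k where "k = pair C (TA C r0) (TA C r1) u v"
    have k: "k \<in> Arr C" "Dom C k = X" "Cod C k = TO C (Dom C r0)" "TA C r0 \<cdot> k = u" "TA C r1 \<cdot> k = v"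
      using pullback_pair[OF T_pullbackD(2)[OF triples], of u X v] u v r unfolding k_def
      by (simp_all add: Hom_iff)
    have "TA C a \<cdot> k = f" "TA C b \<cdot> k = g" "TA C c \<cdot> k = h"
      using k r u v by (simp_all add: abc TA_comp comp_assoc)
    moreover have "TA C (gsrc \<G>) \<cdot> TA C a = TA C (gtgt \<G>) \<cdot> TA C b"
      "TA C (gsrc \<G>) \<cdot> TA C b = TA C (gtgt \<G>) \<cdot> TA C c"
      using arr ab bc by (simp_all flip: TA_comp)
    moreover have "gmult C ?T (gmult C ?T (TA C a) (TA C b)) (TA C c) \<cdot> k =
        gmult C ?T (TA C a) (gmult C ?T (TA C b) (TA C c)) \<cdot> k"
      using univ arr ab bc by (simp add: TA_gmult)
    ultimately show ?thesis
      using arr k by (simp add: T.gmult_precomp T.gmult_arr[simplified] T.gmult_src[simplified] T.gmult_tgt[simplified])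
  qed
  show ?thesis
  proof unfold_locales
    show "gbase ?T \<in> Obj C" "garr ?T \<in> Obj C"
      "gsrc ?T \<in> Hom C (garr ?T) (gbase ?T)" "gtgt ?T \<in> Hom C (garr ?T) (gbase ?T)"
      "gunit ?T \<in> Hom C (gbase ?T) (garr ?T)" "ginv ?T \<in> Hom C (garr ?T) (garr ?T)"
      "gcomp ?T \<in> Hom C (Dom C (gfst ?T)) (garr ?T)"
      by (simp_all add: Hom_iff)
    show "T_pullback C (gsrc ?T) (gtgt ?T) (gfst ?T) (gsnd ?T)"
      using T_pullbackD(3)[OF composable_pairs] by simp
    show "\<exists>r0 r1. T_pullback C (gsnd ?T) (gfst ?T) r0 r1"
      using composable_triples T_pullbackD(3) by fastforce
    show "gsrc ?T \<cdot> gunit ?T = Id C (gbase ?T)" "gtgt ?T \<cdot> gunit ?T = Id C (gbase ?T)"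
      using src_unit tgt_unit by (simp_all add: TA_Id flip: TA_comp)
    show "gsrc ?T \<cdot> gcomp ?T = gsrc ?T \<cdot> gsnd ?T" "gtgt ?T \<cdot> gcomp ?T = gtgt ?T \<cdot> gfst ?T"
      by (rule T.source_comp T.target_comp)+
    show "gsrc ?T \<cdot> ginv ?T = gtgt ?T" "gtgt ?T \<cdot> ginv ?T = gsrc ?T"
      using src_inv tgt_inv by (simp_all flip: TA_comp)
  qed (fact unitR unitL assoc invR invL)+
qed


lemma composition_structures:
  "composition_structure C (T_groupoid C \<G>)"
  "composition_structure C (T_groupoid C (T_groupoid C \<G>))"
  using composition_structure_T groupoid_in.composition_structure_T[OF groupoid_T] by blast+

end

section \<open>Structural maps as internal functors\<close>

context tangent_category
begin

lemma Tp_nat: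
  assumes "f \<in> Arr C" "Cod C f = Y" "x \<in> Arr C" "Cod C x = TO C (TO C (Dom C f))"
  shows "TA C (tp C Y) \<cdot> (TA C (TA C f) \<cdot> x) = TA C f \<cdot> (TA C (tp C (Dom C f)) \<cdot> x)"
proof -
  have Y: "Y \<in> Obj C" using assms by auto
  have "TA C (tp C Y) \<cdot> TA C (TA C f) = TA C f \<cdot> TA C (tp C (Dom C f))"
    using tp_nat[of f "Dom C f" Y] assms Y by (simp add: Hom_iff flip: TA_comp)
  then show ?thesis
    by (rule comp_exchange) (use assms Y in auto)
qed

lemma c_0_0:
  assumes "X \<in> Obj C" "x \<in> Arr C" "Cod C x = X"
  shows "tc C X \<cdot> (tzero C (TO C X) \<cdot> (tzero C X \<cdot> x)) = tzero C (TO C X) \<cdot> (tzero C X \<cdot> x)"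
  using assms by (simp add: c_T0 zero_nat[of "tzero C X"])

end

context groupoid_in
begin

lemma c_gmult:
  assumes "g \<in> Arr C" "Cod C g = TO C (TO C (garr \<G>))" "h \<in> Arr C" "Cod C h = TO C (TO C (garr \<G>))"
    and "Dom C g = Dom C h" "TA C (TA C (gsrc \<G>)) \<cdot> g = TA C (TA C (gtgt \<G>)) \<cdot> h"
  shows "tc C (garr \<G>) \<cdot> gmult C (T_groupoid C (T_groupoid C \<G>)) g h =
      gmult C (T_groupoid C (T_groupoid C \<G>)) (tc C (garr \<G>) \<cdot> g) (tc C (garr \<G>) \<cdot> h)"
  by (rule gmult_map[OF composition_structures(2) composition_structures(2),
        where \<psi> = "tc C (Dom C (gfst \<G>))"])
    (use assms in \<open>simp_all add: Hom_iff tc_nat\<close>)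

lemma p_gmult:
  assumes "g \<in> Arr C" "Cod C g = TO C (TO C (garr \<G>))" "h \<in> Arr C" "Cod C h = TO C (TO C (garr \<G>))"
    and "Dom C g = Dom C h" "TA C (TA C (gsrc \<G>)) \<cdot> g = TA C (TA C (gtgt \<G>)) \<cdot> h"
  shows "tp C (TO C (garr \<G>)) \<cdot> gmult C (T_groupoid C (T_groupoid C \<G>)) g h =
      gmult C (T_groupoid C \<G>) (tp C (TO C (garr \<G>)) \<cdot> g) (tp C (TO C (garr \<G>)) \<cdot> h)"
  by (rule gmult_map[OF composition_structures(2) composition_structures(1),
        where \<psi> = "tp C (TO C (Dom C (gfst \<G>)))"])
    (use assms in \<open>simp_all add: Hom_iff tp_nat\<close>)

lemma Tp_gmult:
  assumes "g \<in> Arr C" "Cod C g = TO C (TO C (garr \<G>))" "h \<in> Arr C" "Cod C h = TO C (TO C (garr \<G>))"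
    and "Dom C g = Dom C h" "TA C (TA C (gsrc \<G>)) \<cdot> g = TA C (TA C (gtgt \<G>)) \<cdot> h"
  shows "TA C (tp C (garr \<G>)) \<cdot> gmult C (T_groupoid C (T_groupoid C \<G>)) g h =
      gmult C (T_groupoid C \<G>) (TA C (tp C (garr \<G>)) \<cdot> g) (TA C (tp C (garr \<G>)) \<cdot> h)"
  by (rule gmult_map[OF composition_structures(2) composition_structures(1),
        where \<psi> = "TA C (tp C (Dom C (gfst \<G>)))"])
    (use assms in \<open>simp_all add: Hom_iff tp_nat flip: TA_comp\<close>)

end

section \<open>The action on generalised elements of the prolongation\<close>

text \<open>The composite \<open>cW \<circ> 0V \<circ> (c0pW)\<inverse>\<close> in \<open>T\<^sup>2(G)\<close>, for generalised elements \<open>V\<close> of \<open>T(G)\<close>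
  and \<open>W\<close> of \<open>T\<^sup>2(G)\<close> with the same domain.\<close>

definition alpha_el ::
  "('o, 'a, 'z) tancat_scheme \<Rightarrow> ('o, 'a) groupoid \<Rightarrow> 'a \<Rightarrow> 'a \<Rightarrow> 'a" where
  "alpha_el C \<G> V W =
     gmult C (T_groupoid C (T_groupoid C \<G>))
       (gmult C (T_groupoid C (T_groupoid C \<G>))
         (Comp C (tc C (garr \<G>)) W) (Comp C (tzero C (TO C (garr \<G>))) V))
       (Comp C (TA C (TA C (ginv \<G>)))
         (Comp C (tc C (garr \<G>)) (Comp C (tzero C (TO C (garr \<G>))) (Comp C (tp C (TO C (garr \<G>))) W))))"

text \<open>A generalised element \<open>(v, w)\<close> of the prolongation, given by its images \<open>V = \<iota>v\<close> in \<open>T(G)\<close> and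
  \<open>W = T(\<iota>)w\<close> in \<open>T\<^sup>2(G)\<close>, and by the common value \<open>n = \<varrho>v = T(\<pi>)w\<close> in \<open>T(M)\<close>. The base point
  \<open>\<pi>v\<close> need not be recorded: it is \<open>pn\<close>, because \<open>p\<varrho>v = tpV = te\<pi>v = \<pi>v\<close>.\<close>

locale prolongation_element = groupoid_in C \<G>
  for C :: "('o, 'a, 'z) tancat_scheme" (structure) and \<G> :: "('o, 'a) groupoid" +
  fixes n V W :: 'a
  assumes arr: "n \<in> Arr C" "V \<in> Arr C" "W \<in> Arr C"
    and dom: "Dom C V = Dom C n" "Dom C W = Dom C n"
    and cod: "Cod C n = TO C (gbase \<G>)" "Cod C V = TO C (garr \<G>)" "Cod C W = TO C (TO C (garr \<G>))"
    and p_V: "tp C (garr \<G>) \<cdot> V = gunit \<G> \<cdot> (tp C (gbase \<G>) \<cdot> n)"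
    and s_V: "TA C (gsrc \<G>) \<cdot> V = tzero C (gbase \<G>) \<cdot> (tp C (gbase \<G>) \<cdot> n)"
    and t_V: "TA C (gtgt \<G>) \<cdot> V = n"
    and Tp_W: "TA C (tp C (garr \<G>)) \<cdot> W = TA C (gunit \<G>) \<cdot> n"
    and s_W: "TA C (TA C (gsrc \<G>)) \<cdot> W = TA C (tzero C (gbase \<G>)) \<cdot> n"
begin

interpretation T1: groupoid_in C "T_groupoid C \<G>" by (rule groupoid_T)
interpretation T2: groupoid_in C "T_groupoid C (T_groupoid C \<G>)" by (rule T1.groupoid_T)

abbreviation "M \<equiv> gbase \<G>"
abbreviation "G \<equiv> garr \<G>"
abbreviation "pW \<equiv> tp C (TO C G) \<cdot> W"

lemmas el [simp] = arr dom cod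

lemma s_pW: "TA C (gsrc \<G>) \<cdot> pW = tzero C M \<cdot> (tp C M \<cdot> n)"
proof -
  have "TA C (gsrc \<G>) \<cdot> pW = tp C (TO C M) \<cdot> (TA C (TA C (gsrc \<G>)) \<cdot> W)"
    by (simp add: p_nat)
  also have "\<dots> = tzero C M \<cdot> (tp C M \<cdot> n)"
    by (simp add: s_W p_nat)
  finally show ?thesis .
qed

lemma p_pW: "tp C G \<cdot> pW = gunit \<G> \<cdot> (tp C M \<cdot> n)"
proof -
  have "tp C G \<cdot> pW = tp C G \<cdot> (TA C (tp C G) \<cdot> W)"
    by (simp add: p_nat)
  also have "\<dots> = gunit \<G> \<cdot> (tp C M \<cdot> n)"
    by (simp add: Tp_W p_nat)
  finally show ?thesis .
qed

lemma zero_unit: "tzero C G \<cdot> (gunit \<G> \<cdot> (tp C M \<cdot> n)) = TA C (gunit \<G>) \<cdot> (tzero C M \<cdot> (tp C M \<cdot> n))"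
  by (simp add: zero_nat)

text \<open>Sources and targets in \<open>T\<^sup>2(G)\<close> of the factors of \<open>\<alpha>(v, w)\<close> and of their images under \<open>c\<close>.\<close>

lemma s_cW: "TA C (TA C (gsrc \<G>)) \<cdot> (tc C G \<cdot> W) = tzero C (TO C M) \<cdot> n"
  using c_nat[of "gsrc \<G>" _ W] by (simp add: s_W c_T0)

lemma t_cW: "TA C (TA C (gtgt \<G>)) \<cdot> (tc C G \<cdot> W) = tc C M \<cdot> (TA C (TA C (gtgt \<G>)) \<cdot> W)"
  by (simp add: c_nat)

lemma s_0V: "TA C (TA C (gsrc \<G>)) \<cdot> (tzero C (TO C G) \<cdot> V) =
    tzero C (TO C M) \<cdot> (tzero C M \<cdot> (tp C M \<cdot> n))"
  using zero_nat[of "TA C (gsrc \<G>)" _ V] by (simp add: s_V)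

lemma t_0V: "TA C (TA C (gtgt \<G>)) \<cdot> (tzero C (TO C G) \<cdot> V) = tzero C (TO C M) \<cdot> n"
  using zero_nat[of "TA C (gtgt \<G>)" _ V] by (simp add: t_V)

lemma s_c0V: "TA C (TA C (gsrc \<G>)) \<cdot> (tc C G \<cdot> (tzero C (TO C G) \<cdot> V)) =
    tzero C (TO C M) \<cdot> (tzero C M \<cdot> (tp C M \<cdot> n))"
  using c_nat[of "gsrc \<G>" _ "tzero C (TO C G) \<cdot> V"] by (simp add: s_0V c_0_0)

lemma t_c0V: "TA C (TA C (gtgt \<G>)) \<cdot> (tc C G \<cdot> (tzero C (TO C G) \<cdot> V)) = TA C (tzero C M) \<cdot> n"
  using c_nat[of "gtgt \<G>" _ "tzero C (TO C G) \<cdot> V"] by (simp add: t_0V c_0)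

lemma s_0pW: "TA C (TA C (gsrc \<G>)) \<cdot> (tzero C (TO C G) \<cdot> pW) =
    tzero C (TO C M) \<cdot> (tzero C M \<cdot> (tp C M \<cdot> n))"
  using zero_nat[of "TA C (gsrc \<G>)" _ pW] by (simp add: s_pW)

lemma s_c0pW: "TA C (TA C (gsrc \<G>)) \<cdot> (tc C G \<cdot> (tzero C (TO C G) \<cdot> pW)) =
    tzero C (TO C M) \<cdot> (tzero C M \<cdot> (tp C M \<cdot> n))"
  using c_nat[of "gsrc \<G>" _ "tzero C (TO C G) \<cdot> pW"] by (simp add: s_0pW c_0_0)

lemma t_c0pW: "TA C (TA C (gtgt \<G>)) \<cdot> (tc C G \<cdot> (tzero C (TO C G) \<cdot> pW)) =
    TA C (tzero C M) \<cdot> (TA C (gtgt \<G>) \<cdot> pW)"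
proof -
  have "TA C (TA C (gtgt \<G>)) \<cdot> (tzero C (TO C G) \<cdot> pW) = tzero C (TO C M) \<cdot> (TA C (gtgt \<G>) \<cdot> pW)"
    using zero_nat[of "TA C (gtgt \<G>)" _ pW] by simp
  with c_nat[of "gtgt \<G>" _ "tzero C (TO C G) \<cdot> pW"] c_0[of M "TA C (gtgt \<G>) \<cdot> pW"]
  show ?thesis by simp
qed

lemmas sources_targets = s_cW t_cW s_0V t_0V s_c0V t_c0V s_0pW s_c0pW t_c0pW s_W s_V t_V

lemmas T2_simps = T2.gmult_arr[simplified] T2.gmult_src[simplified] T2.gmult_tgt[simplified]
  T2.src_inv_el[simplified] T2.tgt_inv_el[simplified]

lemma alpha_el_arr [simp]:
  "alpha_el C \<G> V W \<in> Arr C" "Dom C (alpha_el C \<G> V W) = Dom C n"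
  "Cod C (alpha_el C \<G> V W) = TO C (TO C G)"
  by (simp_all add: alpha_el_def T2_simps sources_targets)

lemma t_alpha: "TA C (TA C (gtgt \<G>)) \<cdot> alpha_el C \<G> V W = tc C M \<cdot> (TA C (TA C (gtgt \<G>)) \<cdot> W)"
  by (simp add: alpha_el_def T2_simps sources_targets)

lemma s_alpha: "TA C (TA C (gsrc \<G>)) \<cdot> alpha_el C \<G> V W = TA C (tzero C M) \<cdot> (TA C (gtgt \<G>) \<cdot> pW)"
  by (simp add: alpha_el_def T2_simps sources_targets)

lemma alpha_el_precomp:
  assumes "k \<in> Arr C" "Cod C k = Dom C n"
  shows "alpha_el C \<G> V W \<cdot> k = alpha_el C \<G> (V \<cdot> k) (W \<cdot> k)"
  using assms by (simp add: alpha_el_def T2.gmult_precomp T2_simps sources_targets comp_assoc)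

lemma Tp_alpha: "TA C (tp C G) \<cdot> alpha_el C \<G> V W = TA C (gunit \<G>) \<cdot> (TA C (gtgt \<G>) \<cdot> pW)"
proof -
  have "TA C (tp C G) \<cdot> (tzero C (TO C G) \<cdot> V) = TA C (gunit \<G>) \<cdot> (tzero C M \<cdot> (tp C M \<cdot> n))"
    using zero_nat[of "tp C G" _ V] by (simp add: p_V zero_unit)
  then have "TA C (tp C G) \<cdot> alpha_el C \<G> V W =
      gmult C (T_groupoid C \<G>)
        (gmult C (T_groupoid C \<G>) pW (TA C (gunit \<G>) \<cdot> (tzero C M \<cdot> (tp C M \<cdot> n))))
        (TA C (ginv \<G>) \<cdot> pW)"
    by (simp add: alpha_el_def Tp_gmult T2_simps sources_targets Tp_nat Tp_c p_0)
  also have "gmult C (T_groupoid C \<G>) pW (TA C (gunit \<G>) \<cdot> (tzero C M \<cdot> (tp C M \<cdot> n))) = pW"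
    by (rule T1.mult_unit[simplified]) (simp_all add: s_pW)
  also have "gmult C (T_groupoid C \<G>) pW (TA C (ginv \<G>) \<cdot> pW) = TA C (gunit \<G>) \<cdot> (TA C (gtgt \<G>) \<cdot> pW)"
    by (rule T1.mult_inv_self[simplified]) simp_all
  finally show ?thesis .
qed

lemma p_alpha: "tp C (TO C G) \<cdot> alpha_el C \<G> V W = V"
proof -
  have unit: "TA C (tp C G) \<cdot> (tzero C (TO C G) \<cdot> pW) =
      TA C (gunit \<G>) \<cdot> (tzero C M \<cdot> (tp C M \<cdot> n))"
    using zero_nat[of "tp C G" _ pW] by (simp add: p_pW zero_unit)
  have inv: "tp C (TO C G) \<cdot> (TA C (TA C (ginv \<G>)) \<cdot> (tc C G \<cdot> (tzero C (TO C G) \<cdot> pW))) =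
      TA C (ginv \<G>) \<cdot> (TA C (gunit \<G>) \<cdot> (tzero C M \<cdot> (tp C M \<cdot> n)))"
    by (simp add: p_nat[of "TA C (ginv \<G>)"] p_c unit)
  have "tp C (TO C G) \<cdot> alpha_el C \<G> V W =
      gmult C (T_groupoid C \<G>) (gmult C (T_groupoid C \<G>) (TA C (gunit \<G>) \<cdot> n) V)
        (TA C (ginv \<G>) \<cdot> (TA C (gunit \<G>) \<cdot> (tzero C M \<cdot> (tp C M \<cdot> n))))"
    by (simp add: alpha_el_def p_gmult T2_simps sources_targets inv p_c Tp_W p_0)
  also have "gmult C (T_groupoid C \<G>) (TA C (gunit \<G>) \<cdot> n) V = V"
    by (rule T1.unit_mult[simplified]) (simp_all add: t_V)
  also have "gmult C (T_groupoid C \<G>) V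
      (TA C (ginv \<G>) \<cdot> (TA C (gunit \<G>) \<cdot> (tzero C M \<cdot> (tp C M \<cdot> n)))) = V"
    by (rule T1.mult_inv_unit[simplified]) (simp_all add: s_V)
  finally show ?thesis .
qed

lemma alpha_involution: "alpha_el C \<G> pW (alpha_el C \<G> V W) = W"
proof -
  let ?m = "gmult C (T_groupoid C (T_groupoid C \<G>))" and ?i = "TA C (TA C (ginv \<G>))"
  let ?a = "tc C G \<cdot> (tzero C (TO C G) \<cdot> V)" and ?b = "tzero C (TO C G) \<cdot> pW"
  have "tc C G \<cdot> alpha_el C \<G> V W = ?m (?m W ?a) (?i \<cdot> ?b)"
    by (simp add: alpha_el_def c_gmult T2_simps sources_targets c_nat[of "ginv \<G>"] c_c)
  then have "alpha_el C \<G> pW (alpha_el C \<G> V W) = ?m (?m (?m (?m W ?a) (?i \<cdot> ?b)) ?b) (?i \<cdot> ?a)"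
    by (simp add: alpha_el_def[of C \<G> pW] p_alpha)
  also have "?m (?m (?m W ?a) (?i \<cdot> ?b)) ?b = ?m W ?a"
    by (rule T2.inv_mult_cancel[simplified]) (simp_all add: T2_simps sources_targets)
  also have "?m (?m W ?a) (?i \<cdot> ?a) = W"
    by (rule T2.mult_inv_cancel[simplified]) (simp_all add: sources_targets)
  finally show ?thesis .
qed

end

text \<open>Pairing the lift of \<open>u\<close> with the zero vector over the same base point \<open>x\<close>: the second and
  the third factor of \<open>\<alpha>\<close> are then units.\<close>

lemma (in groupoid_in) alpha_zero_lift:
  assumes x: "x \<in> Arr C" "Cod C x = gbase \<G>"
    and u: "u \<in> Arr C" "Dom C u = Dom C x" "Cod C u = TO C (garr \<G>)"
    and p_u: "tp C (garr \<G>) \<cdot> u = gunit \<G> \<cdot> x"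
    and s_u: "TA C (gsrc \<G>) \<cdot> u = tzero C (gbase \<G>) \<cdot> x"
  shows "alpha_el C \<G> (tzero C (garr \<G>) \<cdot> (gunit \<G> \<cdot> x)) (tl C (garr \<G>) \<cdot> u) = tl C (garr \<G>) \<cdot> u"
proof -
  interpret T1: groupoid_in C "T_groupoid C \<G>" by (rule groupoid_T)
  interpret T2: groupoid_in C "T_groupoid C (T_groupoid C \<G>)" by (rule T1.groupoid_T)
  let ?G = "garr \<G>" and ?M = "gbase \<G>"
  let ?W = "tl C ?G \<cdot> u"
  note [simp] = x u
  have zero_unit: "tzero C ?G \<cdot> (gunit \<G> \<cdot> x) = TA C (gunit \<G>) \<cdot> (tzero C ?M \<cdot> x)"
    by (simp add: zero_nat)
  have s_W: "TA C (TA C (gsrc \<G>)) \<cdot> ?W = TA C (tzero C ?M) \<cdot> (tzero C ?M \<cdot> x)"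
    using l_nat[of "gsrc \<G>" _ u] by (simp add: s_u l_0)
  have zero_zero: "tzero C (TO C ?G) \<cdot> (tzero C ?G \<cdot> (gunit \<G> \<cdot> x)) =
      TA C (TA C (gunit \<G>)) \<cdot> (TA C (tzero C ?M) \<cdot> (tzero C ?M \<cdot> x))"
    using zero_nat[of "TA C (gunit \<G>)" _ "tzero C ?M \<cdot> x"] zero_nat[of "tzero C ?M" _ x]
    by (simp add: zero_unit)
  have "gmult C (T_groupoid C (T_groupoid C \<G>)) ?W
      (TA C (TA C (gunit \<G>)) \<cdot> (TA C (tzero C ?M) \<cdot> (tzero C ?M \<cdot> x))) = ?W"
    by (rule T2.mult_unit[simplified]) (simp_all add: s_W)
  moreover have "gmult C (T_groupoid C (T_groupoid C \<G>)) ?W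
      (TA C (TA C (ginv \<G>)) \<cdot> (TA C (TA C (gunit \<G>)) \<cdot> (TA C (tzero C ?M) \<cdot> (tzero C ?M \<cdot> x)))) = ?W"
    by (rule T2.mult_inv_unit[simplified]) (simp_all add: s_W)
  moreover note c_0_0[of ?G "gunit \<G> \<cdot> x", unfolded zero_zero]
  ultimately show ?thesis
    by (simp add: alpha_el_def c_l p_l p_u zero_zero)
qed

section \<open>The associated bundle and the action map\<close>

lemma T_productD:
  assumes "T_product C A B r0 r1"
  shows "is_product C A B r0 r1" "is_product C (TO C A) (TO C B) (TA C r0) (TA C r1)"
proof -
  have "is_product C ((TO C ^^ k) A) ((TO C ^^ k) B) ((TA C ^^ k) r0) ((TA C ^^ k) r1)" for k
    using assms by (simp add: T_product_def)
  from this[of 0] this[of 1]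
  show "is_product C A B r0 r1" "is_product C (TO C A) (TO C B) (TA C r0) (TA C r1)" by simp_all
qed

locale associated_anchored_bundle = groupoid_in C \<G>
  for C :: "('o, 'a, 'z) tancat_scheme" (structure) and \<G> :: "('o, 'a) groupoid" +
  fixes \<pi> \<iota> :: 'a
  assumes is_associated: "associated_bundle C \<G> \<pi> \<iota>"
begin

text \<open>The universal properties of \<open>A\<close> and of \<open>T(A)\<close>, with the product \<open>G \<times> T(M)\<close> eliminated:
  elements of \<open>A\<close> are elements \<open>u\<close> of \<open>T(G)\<close> with \<open>pu = en\<close> and \<open>T(s)u = 0n\<close> for some \<open>n\<close>, and
  elements of \<open>T(A)\<close> are described by \<open>T\<close> of these equations. Both \<open>\<iota>\<close> and \<open>T(\<iota>)\<close> are
  monomorphisms, being pullbacks of \<open>(e, 0)\<close> and \<open>T(e, 0)\<close>; the first of these is split by \<open>s\<close> after the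
  projection to \<open>G\<close>, because \<open>se = id\<close>, and the second by \<open>T\<close> of that arrow.\<close>

lemma
  shows bundle_arr [simp]: "\<iota> \<in> Arr C" "Cod C \<iota> = TO C (garr \<G>)"
      "\<pi> \<in> Arr C" "Dom C \<pi> = Dom C \<iota>" "Cod C \<pi> = gbase \<G>"
    and p_iota: "tp C (garr \<G>) \<cdot> \<iota> = gunit \<G> \<cdot> \<pi>"
    and s_iota: "TA C (gsrc \<G>) \<cdot> \<iota> = tzero C (gbase \<G>) \<cdot> \<pi>"
    and factor: "u \<in> Arr C \<Longrightarrow> Cod C u = TO C (garr \<G>) \<Longrightarrow> n \<in> Arr C \<Longrightarrow> Dom C n = Dom C u \<Longrightarrow>
      Cod C n = gbase \<G> \<Longrightarrow> tp C (garr \<G>) \<cdot> u = gunit \<G> \<cdot> n \<Longrightarrow>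
      TA C (gsrc \<G>) \<cdot> u = tzero C (gbase \<G>) \<cdot> n \<Longrightarrow>
      \<exists>h \<in> Hom C (Dom C u) (Dom C \<iota>). \<iota> \<cdot> h = u \<and> \<pi> \<cdot> h = n"
    and T_factor: "u' \<in> Arr C \<Longrightarrow> Cod C u' = TO C (TO C (garr \<G>)) \<Longrightarrow> n' \<in> Arr C \<Longrightarrow>
      Dom C n' = Dom C u' \<Longrightarrow> Cod C n' = TO C (gbase \<G>) \<Longrightarrow>
      TA C (tp C (garr \<G>)) \<cdot> u' = TA C (gunit \<G>) \<cdot> n' \<Longrightarrow>
      TA C (TA C (gsrc \<G>)) \<cdot> u' = TA C (tzero C (gbase \<G>)) \<cdot> n' \<Longrightarrow>
      \<exists>h \<in> Hom C (Dom C u') (TO C (Dom C \<iota>)). TA C \<iota> \<cdot> h = u' \<and> TA C \<pi> \<cdot> h = n'"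
    and mono: "h \<in> Hom C X (Dom C \<iota>) \<Longrightarrow> h' \<in> Hom C X (Dom C \<iota>) \<Longrightarrow> \<iota> \<cdot> h = \<iota> \<cdot> h' \<Longrightarrow> h = h'"
    and T_mono: "k \<in> Hom C X (TO C (Dom C \<iota>)) \<Longrightarrow> k' \<in> Hom C X (TO C (Dom C \<iota>)) \<Longrightarrow>
      TA C \<iota> \<cdot> k = TA C \<iota> \<cdot> k' \<Longrightarrow> k = k'"
proof -
  let ?G = "garr \<G>" and ?M = "gbase \<G>"
  obtain q0 q1 where prod: "T_product C ?G (TO C ?M) q0 q1"
    and pb: "T_pullback C (pair C q0 q1 (tp C ?G) (TA C (gsrc \<G>)))
      (pair C q0 q1 (gunit \<G>) (tzero C ?M)) \<iota> \<pi>"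
    using is_associated unfolding associated_bundle_def by blast
  define f g where fg: "f = pair C q0 q1 (tp C ?G) (TA C (gsrc \<G>))"
    "g = pair C q0 q1 (gunit \<G>) (tzero C ?M)"
  note prod0 = T_productD(1)[OF prod] and prod1 = T_productD(2)[OF prod]
  note pb0 = T_pullbackD(1)[OF pb, folded fg] and pb1 = T_pullbackD(2)[OF pb, folded fg]
  have q [simp]: "q0 \<in> Arr C" "q1 \<in> Arr C" "Dom C q1 = Dom C q0" "Cod C q0 = ?G" "Cod C q1 = TO C ?M"
    using prod0 by (auto simp: is_product_def Hom_iff)
  have f [simp]: "f \<in> Arr C" "Dom C f = TO C ?G" "Cod C f = Dom C q0"
    and qf: "q0 \<cdot> f = tp C ?G" "q1 \<cdot> f = TA C (gsrc \<G>)"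
    using product_pair[OF prod0, of "tp C ?G" "TO C ?G" "TA C (gsrc \<G>)"] by (simp_all add: Hom_iff fg)
  have g [simp]: "g \<in> Arr C" "Dom C g = ?M" "Cod C g = Dom C q0"
    and qg: "q0 \<cdot> g = gunit \<G>" "q1 \<cdot> g = tzero C ?M"
    using product_pair[OF prod0, of "gunit \<G>" ?M "tzero C ?M"] by (simp_all add: Hom_iff fg)
  have Tqf: "TA C q0 \<cdot> TA C f = TA C (tp C ?G)" "TA C q1 \<cdot> TA C f = TA C (TA C (gsrc \<G>))"
    and Tqg: "TA C q0 \<cdot> TA C g = TA C (gunit \<G>)" "TA C q1 \<cdot> TA C g = TA C (tzero C ?M)"
    using qf qg by (simp_all flip: TA_comp)
  have arr [simp]: "\<iota> \<in> Arr C" "Cod C \<iota> = TO C ?G" "\<pi> \<in> Arr C" "Dom C \<pi> = Dom C \<iota>" "Cod C \<pi> = ?M"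
    using is_pullback_arrD[OF pb0] by simp_all
  have square: "f \<cdot> \<iota> = g \<cdot> \<pi>" using is_pullback_arrD[OF pb0] by simp
  show "tp C ?G \<cdot> \<iota> = gunit \<G> \<cdot> \<pi>"
    unfolding qf(1)[symmetric] qg(1)[symmetric] using square by (simp add: comp_assoc)
  show "TA C (gsrc \<G>) \<cdot> \<iota> = tzero C ?M \<cdot> \<pi>"
    unfolding qf(2)[symmetric] qg(2)[symmetric] using square by (simp add: comp_assoc)
  have retract: "(gsrc \<G> \<cdot> q0) \<cdot> g = Id C ?M"
    using src_unit by (simp add: comp_assoc qg)
  have "TA C (gsrc \<G> \<cdot> q0) \<cdot> TA C g = TA C (Id C ?M)"
    using retract by (simp flip: TA_comp)
  then have Tretract: "TA C (gsrc \<G> \<cdot> q0) \<cdot> TA C g = Id C (Dom C (TA C g))"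
    by (simp add: TA_Id)
  show "\<iota> \<in> Arr C" "Cod C \<iota> = TO C ?G" "\<pi> \<in> Arr C" "Dom C \<pi> = Dom C \<iota>" "Cod C \<pi> = ?M"
    by (fact arr)+
  show "\<exists>h \<in> Hom C (Dom C u) (Dom C \<iota>). \<iota> \<cdot> h = u \<and> \<pi> \<cdot> h = n"
    if "u \<in> Arr C" "Cod C u = TO C ?G" "n \<in> Arr C" "Dom C n = Dom C u" "Cod C n = ?M"
      "tp C ?G \<cdot> u = gunit \<G> \<cdot> n" "TA C (gsrc \<G>) \<cdot> u = tzero C ?M \<cdot> n"
    by (rule pullback_over_product[OF prod0 pb0]) (use that in \<open>simp_all add: Hom_iff qf qg\<close>)
  show "\<exists>h \<in> Hom C (Dom C u') (TO C (Dom C \<iota>)). TA C \<iota> \<cdot> h = u' \<and> TA C \<pi> \<cdot> h = n'"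
    if "u' \<in> Arr C" "Cod C u' = TO C (TO C ?G)" "n' \<in> Arr C" "Dom C n' = Dom C u'"
      "Cod C n' = TO C ?M" "TA C (tp C ?G) \<cdot> u' = TA C (gunit \<G>) \<cdot> n'"
      "TA C (TA C (gsrc \<G>)) \<cdot> u' = TA C (tzero C ?M) \<cdot> n'"
    using pullback_over_product[OF prod1 pb1, of u' "Dom C u'" n'] that by (simp add: Hom_iff Tqf Tqg)
  show "h = h'" if "h \<in> Hom C X (Dom C \<iota>)" "h' \<in> Hom C X (Dom C \<iota>)" "\<iota> \<cdot> h = \<iota> \<cdot> h'"
    by (rule pullback_split_mono[OF pb0, of "gsrc \<G> \<cdot> q0"]) (use that retract in simp_all)
  show "k = k'" if "k \<in> Hom C X (TO C (Dom C \<iota>))" "k' \<in> Hom C X (TO C (Dom C \<iota>))"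
    "TA C \<iota> \<cdot> k = TA C \<iota> \<cdot> k'"
    by (rule pullback_split_mono[OF pb1 _ _ Tretract, where X = X]) (use that in simp_all)
qed

end

theorem lemma3p3p0p8:
  fixes C :: "('o, 'a) tancat" (structure)
    and \<G> :: "('o, 'a) groupoid"
    and \<pi> \<iota> \<pi>0 \<pi>1 :: 'a
  defines "M \<equiv> gbase \<G>"
    and "A \<equiv> Dom C \<iota>"
    and "\<xi> \<equiv> zero_section C \<G> \<iota>"
    and "lam \<equiv> bundle_lift C \<G> \<iota>"
    and "\<rho> \<equiv> anchor C \<G> \<iota>"
    and "\<alpha> \<equiv> alpha C \<G> \<iota> \<pi>0 \<pi>1"
  assumes "tangent_category_with_negatives C"
    and "groupoid_in C \<G>"
    and "associated_bundle C \<G> \<pi> \<iota>"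
    and "prolongation C \<G> \<pi> \<iota> \<pi>0 \<pi>1"
  shows "\<alpha> \<cdot> pair C \<pi>0 \<pi>1 (\<xi> \<cdot> \<pi>) lam = lam \<and>
         TA C \<rho> \<cdot> \<alpha> = tc C M \<cdot> TA C \<rho> \<cdot> \<pi>1 \<and>
         \<alpha> \<cdot> pair C \<pi>0 \<pi>1 (tp C A \<cdot> \<pi>1) \<alpha> = \<pi>1"
proof -
  interpret groupoid_in C \<G> by fact
  interpret associated_anchored_bundle C \<G> \<pi> \<iota> by unfold_locales fact
  let ?G = "garr \<G>"
  have M [simp]: "M \<in> Obj C" and A [simp]: "A \<in> Obj C" and dom [simp]: "Dom C \<iota> = A" "Dom C \<pi> = A"
    and base [simp]: "gbase \<G> = M"
    by (simp_all add: M_def A_def)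
  have rho: "\<rho> = TA C (gtgt \<G>) \<cdot> \<iota>" by (simp add: \<rho>_def anchor_def)

  have "\<exists>h \<in> Hom C M A. \<iota> \<cdot> h = tzero C ?G \<cdot> gunit \<G> \<and> \<pi> \<cdot> h = Id C M"
    using factor[of "tzero C ?G \<cdot> gunit \<G>" "Id C M"] src_unit zero_nat[of "gsrc \<G>" _ "gunit \<G>"]
    by (simp add: p_0)
  then obtain z where z: "z \<in> Arr C" "Dom C z = M" "Cod C z = A" and iota_z: "\<iota> \<cdot> z = tzero C ?G \<cdot> gunit \<G>"
    by (auto simp: Hom_iff)
  have "\<xi> = z"
    unfolding \<xi>_def zero_section_def
    by (rule lift_through_eq[OF _ iota_z _ mono]) (simp_all add: Hom_iff z)
  then have xi [simp]: "\<xi> \<in> Arr C" "Dom C \<xi> = M" "Cod C \<xi> = A" and iota_xi: "\<iota> \<cdot> \<xi> = tzero C ?G \<cdot> gunit \<G>"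
    using z iota_z by simp_all

  have s_l: "TA C (TA C (gsrc \<G>)) \<cdot> (tl C ?G \<cdot> \<iota>) = TA C (tzero C M) \<cdot> (tzero C M \<cdot> \<pi>)"
    using l_nat[of "gsrc \<G>" _ \<iota>] s_iota by (simp add: l_0)
  have "\<exists>h \<in> Hom C A (TO C A). TA C \<iota> \<cdot> h = tl C ?G \<cdot> \<iota> \<and> TA C \<pi> \<cdot> h = tzero C M \<cdot> \<pi>"
    using T_factor[of "tl C ?G \<cdot> \<iota>" "tzero C M \<cdot> \<pi>"] s_l by (simp add: Tp_l p_iota zero_nat)
  then obtain y where y: "y \<in> Arr C" "Dom C y = A" "Cod C y = TO C A" "TA C \<iota> \<cdot> y = tl C ?G \<cdot> \<iota>"
    "TA C \<pi> \<cdot> y = tzero C M \<cdot> \<pi>"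
    by (auto simp: Hom_iff)
  have "lam = y"
    unfolding lam_def bundle_lift_def
    by (rule lift_through_eq[OF _ y(4) _ T_mono]) (simp_all add: Hom_iff y(1-3))
  then have lam [simp]: "lam \<in> Arr C" "Dom C lam = A" "Cod C lam = TO C A"
    and iota_lam: "TA C \<iota> \<cdot> lam = tl C ?G \<cdot> \<iota>" and pi_lam: "TA C \<pi> \<cdot> lam = tzero C M \<cdot> \<pi>"
    using y by simp_all

  have pb: "is_pullback C \<rho> (TA C \<pi>) \<pi>0 \<pi>1"
    using T_pullbackD(1) \<open>prolongation C \<G> \<pi> \<iota> \<pi>0 \<pi>1\<close> by (simp add: prolongation_def \<rho>_def)
  define P where "P = Dom C \<pi>0"
  have pr [simp]: "\<pi>0 \<in> Arr C" "Dom C \<pi>0 = P" "Cod C \<pi>0 = A" "\<pi>1 \<in> Arr C" "Dom C \<pi>1 = P"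
    "Cod C \<pi>1 = TO C A"
    using is_pullback_arrD[OF pb] by (simp_all add: rho P_def)
  have pr_eq: "TA C (gtgt \<G>) \<cdot> (\<iota> \<cdot> \<pi>0) = TA C \<pi> \<cdot> \<pi>1"
    using is_pullback_arrD(9)[OF pb] by (simp add: rho comp_assoc)
  define V W where VW: "V = \<iota> \<cdot> \<pi>0" "W = TA C \<iota> \<cdot> \<pi>1"
  have VW_arr [simp]: "V \<in> Arr C" "Dom C V = P" "Cod C V = TO C ?G" "W \<in> Arr C" "Dom C W = P"
    "Cod C W = TO C (TO C ?G)"
    by (simp_all add: VW)

  interpret generic: prolongation_element C \<G> "TA C \<pi> \<cdot> \<pi>1" V W
  proof unfold_locales
    have base_point: "tp C M \<cdot> (TA C \<pi> \<cdot> \<pi>1) = \<pi> \<cdot> \<pi>0"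
    proof -
      have "tp C M \<cdot> (TA C \<pi> \<cdot> \<pi>1) = gtgt \<G> \<cdot> (tp C ?G \<cdot> (\<iota> \<cdot> \<pi>0))"
        by (simp add: p_nat flip: pr_eq)
      also have "\<dots> = gtgt \<G> \<cdot> (gunit \<G> \<cdot> (\<pi> \<cdot> \<pi>0))"
        by (subst comp_exchange[OF p_iota]) simp_all
      finally show ?thesis by simp
    qed
    show "tp C (garr \<G>) \<cdot> V = gunit \<G> \<cdot> (tp C (gbase \<G>) \<cdot> (TA C \<pi> \<cdot> \<pi>1))"
      using comp_exchange[OF p_iota, of \<pi>0] by (simp add: VW base_point)
    show "TA C (gsrc \<G>) \<cdot> V = tzero C (gbase \<G>) \<cdot> (tp C (gbase \<G>) \<cdot> (TA C \<pi> \<cdot> \<pi>1))"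
      using comp_exchange[OF s_iota, of \<pi>0] by (simp add: VW base_point)
    have "TA C (tp C ?G) \<cdot> TA C \<iota> = TA C (gunit \<G>) \<cdot> TA C \<pi>"
      using p_iota by (simp flip: TA_comp)
    from comp_exchange[OF this, of \<pi>1] show "TA C (tp C ?G) \<cdot> W = TA C (gunit \<G>) \<cdot> (TA C \<pi> \<cdot> \<pi>1)"
      by (simp add: VW)
    have "TA C (TA C (gsrc \<G>)) \<cdot> TA C \<iota> = TA C (tzero C M) \<cdot> TA C \<pi>"
      using s_iota by (simp flip: TA_comp)
    from comp_exchange[OF this, of \<pi>1]
    show "TA C (TA C (gsrc \<G>)) \<cdot> W = TA C (tzero C (gbase \<G>)) \<cdot> (TA C \<pi> \<cdot> \<pi>1)"
      by (simp add: VW)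
  qed (simp_all add: VW pr_eq)

  have p_W: "tp C (TO C ?G) \<cdot> W = \<iota> \<cdot> (tp C A \<cdot> \<pi>1)"
    by (simp add: VW p_nat)
  \<comment> \<open>The composite in \<open>T\<^sup>2(G)\<close> lies in \<open>T(A)\<close>, over \<open>\<varrho>pw\<close>.\<close>
  have "\<exists>h \<in> Hom C P (TO C A). TA C \<iota> \<cdot> h = alpha_el C \<G> V W \<and>
      TA C \<pi> \<cdot> h = TA C (gtgt \<G>) \<cdot> (tp C (TO C ?G) \<cdot> W)"
    using T_factor[of "alpha_el C \<G> V W" "TA C (gtgt \<G>) \<cdot> (tp C (TO C ?G) \<cdot> W)"]
      generic.Tp_alpha generic.s_alpha by simp
  then obtain a where a: "a \<in> Arr C" "Dom C a = P" "Cod C a = TO C A"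
    "TA C \<iota> \<cdot> a = alpha_el C \<G> V W" "TA C \<pi> \<cdot> a = TA C (gtgt \<G>) \<cdot> (tp C (TO C ?G) \<cdot> W)"
    by (auto simp: Hom_iff)
  have "\<alpha> = lift_through C (TA C \<iota>) (alpha_el C \<G> V W)"
    by (simp add: \<alpha>_def alpha_def alpha_el_def Let_def VW)
  also have "\<dots> = a"
    by (rule lift_through_eq[OF _ a(4) _ T_mono]) (simp_all add: Hom_iff a(1-3))
  finally have alpha [simp]: "\<alpha> \<in> Arr C" "Dom C \<alpha> = P" "Cod C \<alpha> = TO C A"
    and iota_alpha: "TA C \<iota> \<cdot> \<alpha> = alpha_el C \<G> V W"
    and pi_alpha: "TA C \<pi> \<cdot> \<alpha> = \<rho> \<cdot> (tp C A \<cdot> \<pi>1)"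
    using a p_W by (simp_all add: rho comp_assoc)

  \<comment> \<open>The value of \<open>\<alpha>\<close> on an element \<open>(v, w)\<close> of the prolongation.\<close>
  have alpha_pair: "TA C \<iota> \<cdot> (\<alpha> \<cdot> pair C \<pi>0 \<pi>1 v w) = alpha_el C \<G> (\<iota> \<cdot> v) (TA C \<iota> \<cdot> w)"
    "\<alpha> \<cdot> pair C \<pi>0 \<pi>1 v w \<in> Hom C X (TO C A)"
    if "v \<in> Hom C X A" "w \<in> Hom C X (TO C A)" "\<rho> \<cdot> v = TA C \<pi> \<cdot> w" for v w X
  proof -
    let ?k = "pair C \<pi>0 \<pi>1 v w"
    have k: "?k \<in> Arr C" "Dom C ?k = X" "Cod C ?k = P" "\<pi>0 \<cdot> ?k = v" "\<pi>1 \<cdot> ?k = w"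
      using pullback_pair[OF pb, of v X w] that by (simp_all add: Hom_iff rho)
    have "TA C \<iota> \<cdot> (\<alpha> \<cdot> ?k) = alpha_el C \<G> V W \<cdot> ?k"
      by (rule comp_reassoc[OF iota_alpha]) (simp_all add: k)
    also have "\<dots> = alpha_el C \<G> (V \<cdot> ?k) (W \<cdot> ?k)"
      by (rule generic.alpha_el_precomp) (simp_all add: k)
    finally show "TA C \<iota> \<cdot> (\<alpha> \<cdot> ?k) = alpha_el C \<G> (\<iota> \<cdot> v) (TA C \<iota> \<cdot> w)"
      using k by (simp add: VW comp_assoc)
    show "\<alpha> \<cdot> ?k \<in> Hom C X (TO C A)" using k by (simp add: Hom_iff)
  qed

  have "\<alpha> \<cdot> pair C \<pi>0 \<pi>1 (\<xi> \<cdot> \<pi>) lam = lam"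
  proof -
    have iota_xi_pi: "\<iota> \<cdot> (\<xi> \<cdot> \<pi>) = tzero C ?G \<cdot> (gunit \<G> \<cdot> \<pi>)"
      by (subst comp_exchange[OF iota_xi]) simp_all
    have "\<rho> \<cdot> (\<xi> \<cdot> \<pi>) = TA C (gtgt \<G>) \<cdot> (tzero C ?G \<cdot> (gunit \<G> \<cdot> \<pi>))"
      by (simp add: rho comp_assoc iota_xi_pi)
    also have "\<dots> = TA C \<pi> \<cdot> lam"
      using zero_nat[of "gtgt \<G>" _ "gunit \<G> \<cdot> \<pi>"] by (simp add: pi_lam)
    finally have "\<rho> \<cdot> (\<xi> \<cdot> \<pi>) = TA C \<pi> \<cdot> lam" .
    note pair = alpha_pair[OF _ _ this, of A]
    have "TA C \<iota> \<cdot> (\<alpha> \<cdot> pair C \<pi>0 \<pi>1 (\<xi> \<cdot> \<pi>) lam) = TA C \<iota> \<cdot> lam"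
      using pair(1) alpha_zero_lift[of \<pi> \<iota>] p_iota s_iota
      by (simp add: Hom_iff iota_xi_pi iota_lam)
    then show ?thesis
      by (rule T_mono[rotated 2]) (use pair(2) in \<open>simp_all add: Hom_iff\<close>)
  qed
  moreover have "TA C \<rho> \<cdot> \<alpha> = tc C M \<cdot> TA C \<rho> \<cdot> \<pi>1"
    using generic.t_alpha by (simp add: rho TA_comp comp_assoc iota_alpha VW)
  moreover have "\<alpha> \<cdot> pair C \<pi>0 \<pi>1 (tp C A \<cdot> \<pi>1) \<alpha> = \<pi>1"
  proof -
    note pair = alpha_pair[OF _ _ pi_alpha[symmetric], of P]
    have "TA C \<iota> \<cdot> (\<alpha> \<cdot> pair C \<pi>0 \<pi>1 (tp C A \<cdot> \<pi>1) \<alpha>) = alpha_el C \<G> (tp C (TO C ?G) \<cdot> W) (alpha_el C \<G> V W)"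
      using pair(1) by (simp add: Hom_iff p_W iota_alpha)
    also have "\<dots> = TA C \<iota> \<cdot> \<pi>1"
      using generic.alpha_involution by (simp add: VW)
    finally show ?thesis
      by (rule T_mono[rotated 2]) (use pair(2) in \<open>simp_all add: Hom_iff\<close>)
  qed
  ultimately show ?thesis by blast
qed

end
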